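(* Let $b>0$, $c>0$, $\beta\ge 0$ be fixed. For $J\ge 2$ put $N=2^J-1$, $h=b/(N+1)=b/2^J$, $\delta=ch^{\beta}$ (with $\delta<b$), and let $A_J=A_\delta^h$ be the $N\times N$ nonlocal stiffness matrix. Let $0<\omega<1$ and $0<\eta\le 2\omega(1-\omega)$. Then for all sufficiently small $h$ (i.e. in the regime $h\to 0$), the damped Jacobi iteration matrix $K_J=I-\omega D_J^{-1}A_J$ satisfies $$\|K_J\nu\|_{A_J}^2\le \|\nu\|_{A_J}^2-\eta\,\|A_J\nu\|_{D_J^{-1}}^2\qquad\text{for all }\nu\in\mathbb{R}^N,$$ and the convergence factor of the two-grid method satisfies $$\|K_JT^J\|_{A_J}\le\begin{cases}\sqrt{1-\eta/c_0}<1,\quad c_0=\max(1,2c), & \text{if }\beta\ge1,\\[2pt] \sqrt{1-\eta c^2/(648\,b^2)}<1, & \text{if }\beta=0.\end{cases}$$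
   Context: **Stiffness matrix.** For $b>0$, $N\ge1$, $h=b/(N+1)$, $0<\delta<b$, set $R=\delta/h>0$ and $r=\lfloor R\rfloor$. The matrix $A_\delta^h\in\mathbb{R}^{N\times N}$ is the symmetric Toeplitz matrix with entries $a_{i,j}=a_{|i-j|}$, where $a_k=0$ for $k>r+1$ and: - If $R\le 1$: $a_0=2/h^2$, $a_1=-1/h^2$, and $a_k=0$ for $k\ge2$. - If $R>1$: $a_p=-\dfrac{3}{h^2R^3}$ for $1\le p\le r-1$; $a_r=-\dfrac{3r-1+(R-r)(r^2+rR-2R^2+3r+3R)}{2h^2R^3r}$; $a_{r+1}=-\dfrac{(R-r)(2R^2-rR-r^2)}{2h^2R^3(r+1)}$; $a_0=-2\sum_{p=1}^{r+1}a_p$. **Two-grid operators.** $D_J$ is the diagonal part of $A_J$. The restriction $I_J^{J-1}:\mathbb{R}^{2^J-1}\to\mathbb{R}^{2^{J-1}-1}$ is $(I_J^{J-1}\nu)_i=\frac14(\nu_{2i-1}+2\nu_{2i}+\nu_{2i+1})$, $i=1,\dots,2^{J-1}-1$; the prolongation is $I_{J-1}^J=2(I_J^{J-1})^T$. The coarse matrix is $A_{J-1}=I_J^{J-1}A_JI_{J-1}^J$, and the coarse-grid correction operator is $T^J=I-I_{J-1}^JA_{J-1}^{-1}I_J^{J-1}A_J$. **Norms.** For a symmetric positive definite matrix $M$, $\|\nu\|_M=(M\nu,\nu)^{1/2}$ with the Euclidean inner product, and for a matrix $B$, $\|B\|_M=\sup_{\nu\ne0}\|B\nu\|_M/\|\nu\|_M$.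 (The matrix $A_J$ is symmetric positive definite.) *)

theory Defs
  imports
    Complex_Main
    "Jordan_Normal_Form.Matrix"
    "Jordan_Normal_Form.Gauss_Jordan_Elimination"
begin

text \<open>All matrices have a size that depends on the level \<open>J\<close>, so they are elements of
  \<^typ>\<open>real mat\<close>; rows, columns and vector entries are numbered from \<open>0\<close>.\<close>

text \<open>The Toeplitz coefficients \<open>a\<^sub>k\<close> for \<open>k \<ge> 1\<close>; the value at \<open>k = 0\<close> is irrelevant.\<close>

definition offdiag_coeff :: "real \<Rightarrow> real \<Rightarrow> nat \<Rightarrow> real" where
  "offdiag_coeff h \<delta> k =
    (let R = \<delta> / h; n = nat \<lfloor>R\<rfloor>; r = real n in
      if R \<le> 1 then
        (if k = 1 then - 1 / h^2 else 0)
      else if k < n then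
        - 3 / (h^2 * R^3)
      else if k = n then
        - (3 * r - 1 + (R - r) * (r^2 + r * R - 2 * R^2 + 3 * r + 3 * R)) / (2 * h^2 * R^3 * r)
      else if k = n + 1 then
        - ((R - r) * (2 * R^2 - r * R - r^2)) / (2 * h^2 * R^3 * (r + 1))
      else 0)"

definition stiffness_coeff :: "real \<Rightarrow> real \<Rightarrow> nat \<Rightarrow> real" where
  "stiffness_coeff h \<delta> k =
    (if k = 0 then
       (if \<delta> / h \<le> 1 then 2 / h^2
        else - 2 * (\<Sum>p = 1..nat \<lfloor>\<delta> / h\<rfloor> + 1. offdiag_coeff h \<delta> p))
     else offdiag_coeff h \<delta> k)"

definition stiffness_matrix :: "real \<Rightarrow> nat \<Rightarrow> real \<Rightarrow> real mat" where
  "stiffness_matrix b N \<delta> =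
    (let h = b / (real N + 1) in
      mat N N (\<lambda>(i, j). stiffness_coeff h \<delta> (if i \<le> j then j - i else i - j)))"

text \<open>The result is unspecified for singular matrices.\<close>

definition inv_mat :: "real mat \<Rightarrow> real mat" where
  "inv_mat M = the (mat_inverse M)"

definition diag_part :: "real mat \<Rightarrow> real mat" where
  "diag_part A = mat_diag (dim_row A) (\<lambda>i. A $$ (i, i))"

text \<open>With indices from \<open>1\<close>, row \<open>i\<close> has the entries \<open>1/4, 1/2, 1/4\<close> in the columns
  \<open>2i-1, 2i, 2i+1\<close>; with indices from \<open>0\<close> these are the columns \<open>2i, 2i+1, 2i+2\<close>.\<close>

definition restriction :: "nat \<Rightarrow> real mat" where
  "restriction J = mat (2^(J - 1) - 1) (2^J - 1)
    (\<lambda>(i, j). if j = 2 * i + 1 then 1 / 2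
              else if j = 2 * i \<or> j = 2 * i + 2 then 1 / 4
              else 0)"

definition prolongation :: "nat \<Rightarrow> real mat" where
  "prolongation J = 2 \<cdot>\<^sub>m (restriction J)\<^sup>T"

definition coarse_matrix :: "nat \<Rightarrow> real mat \<Rightarrow> real mat" where
  "coarse_matrix J A = restriction J * A * prolongation J"

definition coarse_correction :: "nat \<Rightarrow> real mat \<Rightarrow> real mat" where
  "coarse_correction J A =
    1\<^sub>m (2^J - 1) - prolongation J * inv_mat (coarse_matrix J A) * restriction J * A"

definition damped_jacobi :: "real \<Rightarrow> real mat \<Rightarrow> real mat" where
  "damped_jacobi \<omega> A = 1\<^sub>m (dim_row A) - \<omega> \<cdot>\<^sub>m (inv_mat (diag_part A) * A)"

text \<open>The next two definitions are meant for symmetric positive definite \<open>M\<close>. The supremum is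
  taken in \<^typ>\<open>real\<close>: the set is bounded for such \<open>M\<close>, and nonempty for \<open>dim_row M > 0\<close>.\<close>

definition vec_norm :: "real mat \<Rightarrow> real vec \<Rightarrow> real" where
  "vec_norm M v = sqrt ((M *\<^sub>v v) \<bullet> v)"

definition mat_norm :: "real mat \<Rightarrow> real mat \<Rightarrow> real" where
  "mat_norm M B =
    (SUP v \<in> carrier_vec (dim_row M) - {0\<^sub>v (dim_row M)}. vec_norm M (B *\<^sub>v v) / vec_norm M v)"

end

theory Submission
  imports Defs "Jordan_Normal_Form.Determinant"
begin

text \<open>Since the off-diagonal coefficients are nonpositive and \<open>a\<^sub>0 = -2 \<Sum>a\<^sub>p\<close>, the energy \<open>(A \<nu>, \<nu>)\<close>
  is \<open>\<Sum>(-a\<^sub>p) S\<^sub>p\<close>, where \<open>S\<^sub>p\<close> is the sum of all squares \<open>(\<nu>\<^sub>i\<^sub>+\<^sub>p - \<nu>\<^sub>i)\<^sup>2\<close> of the extension of \<open>\<nu>\<close> by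
  zero. From \<open>S\<^sub>p \<le> 4 \<bar>\<nu>\<bar>\<^sup>2\<close> follows \<open>A \<le> 2 a\<^sub>0\<close>, which is the smoothing property.

  With an approximation property \<open>a\<^sub>0 \<bar>e - P w\<bar>\<^sup>2 \<le> C (A e, e)\<close>, for some \<open>w\<close> depending on \<open>e\<close>,
  Galerkin orthogonality gives \<open>(A e, e) = (A e, e - P w)\<close> for \<open>e = T \<nu>\<close>, hence
  \<open>(A e, e) \<le> C \<bar>A e\<bar>\<^sup>2 / a\<^sub>0\<close>, and the smoothing property yields the factor \<open>1 - \<eta> / C\<close>.

  For \<open>\<beta> \<ge> 1\<close> interpolation at the coarse nodes has \<open>\<bar>e - P w\<bar>\<^sup>2 \<le> S\<^sub>1 / 2\<close>, while \<open>a\<^sub>0 / 2\<close> is at most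
  \<open>-a\<^sub>1\<close> times \<open>1\<close> or \<open>2 R\<close>. For \<open>\<beta> = 0\<close> the choice \<open>w = 0\<close> suffices: telescoping in steps of
  length \<open>p\<close> gives the Poincare inequality \<open>p\<^sup>2 \<bar>e\<bar>\<^sup>2 \<le> 4 (N + 1)\<^sup>2 S\<^sub>p\<close>, and one sums over \<open>p < r\<close>.\<close>

subsection \<open>Finitely supported sequences\<close>

text \<open>For \<open>x\<close> vanishing from \<open>N\<close> on and extended by zero to negative
  indices, this is the sum of \<open>(x (i + p) - x i)\<^sup>2\<close> over all integers
  \<open>i\<close>. The expanded form avoids negative indices and isolates the autocorrelations that
  occur in a Toeplitz form.\<close>

definition shift_energy :: "nat \<Rightarrow> (nat \<Rightarrow> real) \<Rightarrow> nat \<Rightarrow> real" where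
  "shift_energy N x p = 2 * (\<Sum>i<N. (x i)\<^sup>2) - 2 * (\<Sum>i<N. x i * x (i + p))"

lemma sum_squares_shift:
  fixes x :: "nat \<Rightarrow> real"
  assumes "\<And>i. N \<le> i \<Longrightarrow> x i = 0"
  shows "(\<Sum>i<N. (x (i + p))\<^sup>2) + (\<Sum>i<p. (x i)\<^sup>2) = (\<Sum>i<N. (x i)\<^sup>2)"
proof -
  have "(\<Sum>i<N. (x (i + p))\<^sup>2) + (\<Sum>i<p. (x i)\<^sup>2) = (\<Sum>i<N + p. (x i)\<^sup>2)"
    by (induction N) simp_all
  also have "\<dots> = (\<Sum>i<N. (x i)\<^sup>2)"
    by (rule sum.mono_neutral_right) (auto simp: assms)
  finally show ?thesis .
qed

text \<open>The second sum collects the differences that start at the \<open>p\<close> negative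
  indices next to \<open>0\<close>, where the extended sequence is zero.\<close>

lemma shift_energy_eq:
  assumes "\<And>i. N \<le> i \<Longrightarrow> x i = 0"
  shows "shift_energy N x p = (\<Sum>i<N. (x (i + p) - x i)\<^sup>2) + (\<Sum>i<p. (x i)\<^sup>2)"
proof -
  have "(\<Sum>i<N. (x (i + p) - x i)\<^sup>2)
      = (\<Sum>i<N. (x (i + p))\<^sup>2) + (\<Sum>i<N. (x i)\<^sup>2) - 2 * (\<Sum>i<N. x i * x (i + p))"
    by (simp add: power2_diff sum.distrib sum_subtractf sum_distrib_left mult_ac)
  then show ?thesis
    using sum_squares_shift[of N x p] assms by (simp add: shift_energy_def)
qed

lemma shift_energy_nonneg:
  assumes "\<And>i. N \<le> i \<Longrightarrow> x i = 0"
  shows "0 \<le> shift_energy N x p"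
  by (simp add: shift_energy_eq[where N = N, OF assms] sum_nonneg)

text \<open>Replacing differences by sums flips the sign of the autocorrelation, and the two
  nonnegative quantities add up to four times the squared norm.\<close>

lemma shift_energy_le:
  assumes "\<And>i. N \<le> i \<Longrightarrow> x i = 0"
  shows "shift_energy N x p \<le> 4 * (\<Sum>i<N. (x i)\<^sup>2)"
proof -
  have "0 \<le> (\<Sum>i<N. (x (i + p) + x i)\<^sup>2)"
    by (simp add: sum_nonneg)
  also have "\<dots> = (\<Sum>i<N. (x (i + p))\<^sup>2) + (\<Sum>i<N. (x i)\<^sup>2) + 2 * (\<Sum>i<N. x i * x (i + p))"
    by (simp add: power2_sum sum.distrib sum_distrib_left mult_ac)
  moreover have "0 \<le> (\<Sum>i<p. (x i)\<^sup>2)"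
    by (simp add: sum_nonneg)
  ultimately show ?thesis
    using sum_squares_shift[of N x p] assms by (simp add: shift_energy_def)
qed

section \<open>A discrete Poincare inequality\<close>

lemma square_sum_le:
  fixes f :: "nat \<Rightarrow> real"
  shows "(\<Sum>k<m. f k)\<^sup>2 \<le> real m * (\<Sum>k<m. (f k)\<^sup>2)"
proof -
  \<comment> \<open>Lagrange's identity: expanding the double sum gives twice the defect in the
    Cauchy-Schwarz inequality against the constant sequence.\<close>
  have "0 \<le> (\<Sum>i<m. \<Sum>j<m. (f i - f j)\<^sup>2)"
    by (intro sum_nonneg) simp
  also have "\<dots> = 2 * (real m * (\<Sum>k<m. (f k)\<^sup>2)) - 2 * (\<Sum>k<m. f k)\<^sup>2"
    by (simp add: power2_diff sum.distrib sum_subtractf power2_eq_square[of "sum f _"] sum_product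
        sum_distrib_left mult_ac)
  finally show ?thesis by simp
qed

text \<open>From any \<open>i < N\<close>, \<open>m\<close> steps of length \<open>p\<close> leave
  the support, so \<open>x i\<close> is minus a sum of \<open>m\<close> differences. One factor
  \<open>m\<close> comes from Cauchy-Schwarz, the other from adding up the \<open>m\<close> shifted
  sums.\<close>

lemma shift_poincare:
  assumes supp: "\<And>i. N \<le> i \<Longrightarrow> x i = 0" and m: "N \<le> m * p"
  shows "(\<Sum>i<N. (x i)\<^sup>2) \<le> (real m)\<^sup>2 * shift_energy N x p"
proof -
  define d where "d i = x (i + p) - x i" for i
  have "(x i)\<^sup>2 \<le> real m * (\<Sum>k<m. (d (i + k * p))\<^sup>2)" for i
  proof -
    have "(\<Sum>k<m. d (i + k * p)) = x (i + m * p) - x i"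
      using sum_lessThan_telescope[of "\<lambda>k. x (i + k * p)" m]
      by (simp add: d_def algebra_simps)
    also have "\<dots> = - x i" using supp m by simp
    finally show ?thesis
      using square_sum_le[of "\<lambda>k. d (i + k * p)" m] by simp
  qed
  then have "(\<Sum>i<N. (x i)\<^sup>2) \<le> (\<Sum>i<N. real m * (\<Sum>k<m. (d (i + k * p))\<^sup>2))"
    by (intro sum_mono)
  also have "\<dots> = real m * (\<Sum>k<m. \<Sum>i<N. (d (i + k * p))\<^sup>2)"
    by (simp add: sum_distrib_left[symmetric] sum.swap[of _ "{..<m}"])
  also have "\<dots> \<le> real m * (\<Sum>k<m. shift_energy N x p)"
  proof (intro mult_left_mono sum_mono)
    fix k
    \<comment> \<open>The differences vanish from \<open>N\<close> on as well, so shifting their sum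
      of squares can only decrease it.\<close>
    have "d i = 0" if "N \<le> i" for i using that supp by (simp add: d_def)
    from sum_squares_shift[of N d, OF this, of "k * p"]
    have "(\<Sum>i<N. (d (i + k * p))\<^sup>2) + (\<Sum>i<k * p. (d i)\<^sup>2) = (\<Sum>i<N. (d i)\<^sup>2)" .
    moreover have "(\<Sum>i<N. (d i)\<^sup>2) \<le> shift_energy N x p"
      by (simp add: shift_energy_eq[where N = N, OF supp] d_def sum_nonneg)
    moreover have "0 \<le> (\<Sum>i<k * p. (d i)\<^sup>2)" by (simp add: sum_nonneg)
    ultimately show "(\<Sum>i<N. (d (i + k * p))\<^sup>2) \<le> shift_energy N x p" by linarith
  qed simp
  finally show ?thesis by (simp add: power2_eq_square mult.assoc)
qed

lemma shift_poincare_scaled: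
  assumes supp: "\<And>i. N \<le> i \<Longrightarrow> x i = 0" and p: "1 \<le> p" "p \<le> N"
  shows "(real p)\<^sup>2 * (\<Sum>i<N. (x i)\<^sup>2) \<le> 4 * (real N + 1)\<^sup>2 * shift_energy N x p"
proof -
  \<comment> \<open>This is \<open>N / p\<close> rounded up, the least number of steps that leaves
    the support. Multiplying the inequality by the square of \<open>p\<close> produces the square of
    \<open>m * p\<close>, and \<open>m * p \<le> 2 * (N + 1)\<close> yields the factor 4.\<close>
  define m where "m = (N + p - 1) div p"
  have "N + p - 1 = m * p + (N + p - 1) mod p" by (simp add: m_def)
  moreover have "(N + p - 1) mod p < p" using p by simp
  ultimately have lower: "N \<le> m * p" using p by linarith
  have "m * p \<le> N + p - 1" by (simp add: m_def)
  also have "\<dots> \<le> 2 * (N + 1)" using p by simp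
  finally have upper: "m * p \<le> 2 * (N + 1)" .
  from upper have "real (m * p) \<le> real (2 * (N + 1))" by (rule of_nat_mono)
  then have mp: "(real (m * p))\<^sup>2 \<le> (2 * (real N + 1))\<^sup>2" by (intro power_mono) auto
  have "(real p)\<^sup>2 * (\<Sum>i<N. (x i)\<^sup>2) \<le> (real p)\<^sup>2 * ((real m)\<^sup>2 * shift_energy N x p)"
    using shift_poincare[where x = x, OF supp lower] by (intro mult_left_mono) auto
  also have "\<dots> = (real (m * p))\<^sup>2 * shift_energy N x p"
    by (simp add: power_mult_distrib)
  also have "\<dots> \<le> (2 * (real N + 1))\<^sup>2 * shift_energy N x p"
    using mp shift_energy_nonneg[where x = x, OF supp] by (intro mult_right_mono) auto
  finally show ?thesis by (simp only: power_mult_distrib) simp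
qed

section \<open>The error of linear interpolation\<close>

lemma sum_lessThan_even_odd:
  fixes f :: "nat \<Rightarrow> real"
  shows "(\<Sum>k<2 * n + 1. f k) = (\<Sum>i<n + 1. f (2 * i)) + (\<Sum>i<n. f (2 * i + 1))"
  by (induction n) simp_all

text \<open>At an even index the error is half the difference of the two adjacent increments, and
  every increment, including the one from the left boundary value zero to \<open>x 0\<close>, is
  adjacent to exactly one even index. The right boundary value \<open>x (2 * n + 1)\<close> is zero
  by \<open>supp\<close>.\<close>

lemma linear_interpolation_error:
  fixes x :: "nat \<Rightarrow> real"
  assumes supp: "\<And>i. 2 * n + 1 \<le> i \<Longrightarrow> x i = 0"
    and odd: "\<And>i. i < n \<Longrightarrow> e (2 * i + 1) = 0"
    and first: "e 0 = x 0 - x 1 / 2"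
    and even: "\<And>i. i < n \<Longrightarrow> e (2 * i + 2) = x (2 * i + 2) - (x (2 * i + 1) + x (2 * i + 3)) / 2"
  shows "(\<Sum>k<2 * n + 1. (e k)\<^sup>2) \<le> shift_energy (2 * n + 1) x 1 / 2"
proof -
  define d where "d k = x (k + 1) - x k" for k
  have sq: "((s - t) / 2)\<^sup>2 \<le> (s\<^sup>2 + t\<^sup>2) / 2" for s t :: real
    using zero_le_power2[of "s + t"] by (simp add: power2_eq_square field_simps)
  have "(\<Sum>k<2 * n + 1. (e k)\<^sup>2) = (\<Sum>i<n + 1. (e (2 * i))\<^sup>2)"
    by (simp only: sum_lessThan_even_odd) (simp add: odd[simplified])
  also have "\<dots> = (e 0)\<^sup>2 + (\<Sum>i<n. (e (2 * i + 2))\<^sup>2)"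
    by (simp add: sum.lessThan_Suc_shift del: sum.lessThan_Suc)
  also have "\<dots> \<le> ((x 0)\<^sup>2 + (d 0)\<^sup>2) / 2 + (\<Sum>i<n. ((d (2 * i + 1))\<^sup>2 + (d (2 * i + 2))\<^sup>2) / 2)"
  proof (intro add_mono sum_mono)
    show "(e 0)\<^sup>2 \<le> ((x 0)\<^sup>2 + (d 0)\<^sup>2) / 2"
      using sq[of "x 0" "d 0"] by (simp add: first d_def field_simps)
    fix i assume "i \<in> {..<n}"
    then have "e (2 * i + 2) = (d (2 * i + 1) - d (2 * i + 2)) / 2"
      using even[of i] by (simp add: d_def field_simps numeral_eq_Suc)
    then show "(e (2 * i + 2))\<^sup>2 \<le> ((d (2 * i + 1))\<^sup>2 + (d (2 * i + 2))\<^sup>2) / 2"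
      by (simp only: sq)
  qed
  also have "\<dots> = ((x 0)\<^sup>2 + ((\<Sum>i<n + 1. (d (2 * i))\<^sup>2) + (\<Sum>i<n. (d (2 * i + 1))\<^sup>2))) / 2"
    by (simp add: sum.lessThan_Suc_shift sum.distrib sum_divide_distrib[symmetric] add_divide_distrib
        del: sum.lessThan_Suc)
  also have "\<dots> = ((x 0)\<^sup>2 + (\<Sum>k<2 * n + 1. (d k)\<^sup>2)) / 2"
    by (simp only: sum_lessThan_even_odd)
  also have "\<dots> = shift_energy (2 * n + 1) x 1 / 2"
    by (subst shift_energy_eq[where x = x, OF supp]) (simp_all add: d_def)
  finally show ?thesis .
qed

subsection \<open>Toeplitz quadratic forms\<close>

lemma toeplitz_quadratic_form:
  fixes x :: "nat \<Rightarrow> real"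
  assumes supp: "\<And>i. N \<le> i \<Longrightarrow> x i = 0" and L: "N \<le> L"
  shows "(\<Sum>i<N. \<Sum>j<N. a (if i \<le> j then j - i else i - j) * x i * x j)
    = a 0 * (\<Sum>i<N. (x i)\<^sup>2) + 2 * (\<Sum>p = 1..L. a p * (\<Sum>i<N. x i * x (i + p)))"
proof -
  \<comment> \<open>The strict upper triangle; by symmetry the form is twice its sum plus the
    diagonal.\<close>
  define u where "u i j = (if i < j then a (j - i) * x i * x j else 0)" for i j
  have row: "(\<Sum>j<N. u i j) = (\<Sum>p = 1..L. a p * (x i * x (i + p)))" if "i < N" for i
  proof -
    \<comment> \<open>Moving to a window of fixed length \<open>L\<close> adds only indices
      \<open>j \<ge> N\<close>, where \<open>x j = 0\<close>; \<open>L \<ge> N\<close> ensures that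
      no entry is lost.\<close>
    have "(\<Sum>j<N. u i j) = (\<Sum>j\<in>{i + 1..i + L}. a (j - i) * x i * x j)"
      by (rule sum.mono_neutral_cong) (use L that in \<open>auto simp: u_def supp\<close>)
    also have "\<dots> = (\<Sum>p = 1..L. a p * (x i * x (i + p)))"
      by (rule sum.reindex_bij_witness[of _ "\<lambda>p. i + p" "\<lambda>j. j - i"]) (auto simp: mult_ac)
    finally show ?thesis .
  qed
  have upper: "(\<Sum>i<N. \<Sum>j<N. u i j) = (\<Sum>p = 1..L. a p * (\<Sum>i<N. x i * x (i + p)))"
    by (simp add: row sum_distrib_left sum.swap[of _ "{..<N}"])
  have "(\<Sum>i<N. \<Sum>j<N. a (if i \<le> j then j - i else i - j) * x i * x j)
      = (\<Sum>i<N. \<Sum>j<N. u i j + u j i + (if j = i then a 0 * (x i)\<^sup>2 else 0))"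
    by (intro sum.cong refl) (auto simp: u_def power2_eq_square mult_ac)
  also have "\<dots> = (\<Sum>i<N. \<Sum>j<N. u i j) + (\<Sum>i<N. \<Sum>j<N. u j i) + a 0 * (\<Sum>i<N. (x i)\<^sup>2)"
    by (simp add: sum.distrib sum_distrib_left)
  also have "(\<Sum>i<N. \<Sum>j<N. u j i) = (\<Sum>i<N. \<Sum>j<N. u i j)"
    by (rule sum.swap)
  finally show ?thesis using upper by simp
qed

text \<open>The condition on \<open>a 0\<close> distributes the diagonal term over the shifts
  \<open>p\<close>, completing each autocorrelation to a \<open>shift_energy\<close>. Shifts
  \<open>p \<ge> N\<close> lie outside the matrix but contribute to \<open>a 0\<close>, which is why
  the sum runs up to \<open>L\<close>.\<close>

lemma toeplitz_energy:
  fixes x :: "nat \<Rightarrow> real"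
  assumes supp: "\<And>i. N \<le> i \<Longrightarrow> x i = 0" and L: "N \<le> L"
    and diag: "a 0 = - 2 * (\<Sum>p = 1..L. a p)"
  shows "(\<Sum>i<N. \<Sum>j<N. a (if i \<le> j then j - i else i - j) * x i * x j)
    = (\<Sum>p = 1..L. - a p * shift_energy N x p)"
proof -
  have "(\<Sum>p = 1..L. - a p * shift_energy N x p)
      = (\<Sum>p = 1..L. 2 * (a p * (\<Sum>i<N. x i * x (i + p))) + - 2 * (a p * (\<Sum>i<N. (x i)\<^sup>2)))"
    by (simp add: shift_energy_def algebra_simps)
  also have "\<dots> = 2 * (\<Sum>p = 1..L. a p * (\<Sum>i<N. x i * x (i + p)))
      + a 0 * (\<Sum>i<N. (x i)\<^sup>2)"
    by (simp only: sum.distrib sum_distrib_left[symmetric] sum_distrib_right[symmetric] diag)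
  finally show ?thesis
    using toeplitz_quadratic_form[where x = x and a = a, OF supp L] by simp
qed

subsection \<open>Two-grid operators\<close>

lemma inv_mat_eqI:
  assumes M: "M \<in> carrier_mat n n" and B: "B \<in> carrier_mat n n"
    and MB: "M * B = 1\<^sub>m n" and BM: "B * M = 1\<^sub>m n"
  shows "inv_mat M = B"
proof -
  have "M \<in> Units (ring_mat TYPE(real) n ())"
    using assms unfolding Units_def ring_mat_def by auto
  then obtain C where Some: "mat_inverse M = Some C"
    using mat_inverse(1)[OF M, where b = "()"] by (cases "mat_inverse M") auto
  from mat_inverse(2)[OF M Some] have "C * M = 1\<^sub>m n" and C: "C \<in> carrier_mat n n"
    by auto
  then have "B = (C * M) * B" using B by simp
  also have "\<dots> = C * (M * B)" using M B C by (intro assoc_mult_mat) auto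
  also have "\<dots> = C" using C by (simp add: MB)
  finally show ?thesis by (simp add: inv_mat_def Some)
qed

text \<open>Injectivity makes the determinant nonzero. It is meant for the coarse matrix, where
  injectivity follows from positivity of the energy.\<close>

lemma inv_mat_of_injective:
  assumes M: "M \<in> carrier_mat n n"
    and inj: "\<And>v. v \<in> carrier_vec n \<Longrightarrow> M *\<^sub>v v = 0\<^sub>v n \<Longrightarrow> v = 0\<^sub>v n"
  shows "inv_mat M \<in> carrier_mat n n" and "M * inv_mat M = 1\<^sub>m n"
proof -
  have "det M \<noteq> 0"
    using det_0_iff_vec_prod_zero_field[OF M] inj by blast
  then have "M \<in> Units (ring_mat TYPE(real) n ())"
    by (rule det_non_zero_imp_unit[OF M])
  then obtain C where C: "mat_inverse M = Some C"
    using mat_inverse(1)[OF M, where b = "()"] by (cases "mat_inverse M") auto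
  from mat_inverse(2)[OF M C] show "inv_mat M \<in> carrier_mat n n" "M * inv_mat M = 1\<^sub>m n"
    by (auto simp: inv_mat_def C)
qed

lemma inv_diag_part:
  assumes A: "A \<in> carrier_mat N N" and diag: "\<And>i. i < N \<Longrightarrow> A $$ (i, i) = a0" and a0: "a0 \<noteq> 0"
  shows "inv_mat (diag_part A) = (1 / a0) \<cdot>\<^sub>m 1\<^sub>m N"
proof -
  have "diag_part A = a0 \<cdot>\<^sub>m 1\<^sub>m N"
    using A diag by (intro eq_matI) (auto simp: diag_part_def mat_diag_def)
  then show ?thesis
    using a0 by (intro inv_mat_eqI[where n = N])
      (auto simp: mult_smult_distrib mult_smult_assoc_mat[where n = N and nc = N])
qed

lemma smult_mat_mult_vec:
  fixes k :: "'a :: comm_ring"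
  assumes "A \<in> carrier_mat nr nc" and "v \<in> carrier_vec nc"
  shows "(k \<cdot>\<^sub>m A) *\<^sub>v v = k \<cdot>\<^sub>v (A *\<^sub>v v)"
  using assms by (intro eq_vecI) auto

section \<open>Prolongation as linear interpolation\<close>

lemma restriction_carrier: "restriction J \<in> carrier_mat (2 ^ (J - 1) - 1) (2 ^ J - 1)"
  by (simp add: restriction_def)

lemma prolongation_carrier: "prolongation J \<in> carrier_mat (2 ^ J - 1) (2 ^ (J - 1) - 1)"
  by (simp add: prolongation_def restriction_def)

text \<open>The factor 2 turns the weights 1/2 and 1/4 into 1 and 1/2, those of linear interpolation
  with coarse node \<open>l\<close> at the fine index \<open>2 * l + 1\<close>.\<close>

lemma prolongation_apply:
  assumes w: "w \<in> carrier_vec (2 ^ (J - 1) - 1)" and k: "k < 2 ^ J - 1"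
  shows "(prolongation J *\<^sub>v w) $ k
    = (\<Sum>l<2 ^ (J - 1) - 1.
        (if k = 2 * l + 1 then 1 else if k = 2 * l \<or> k = 2 * l + 2 then 1 / 2 else 0) * w $ l)"
  using assms
  by (auto simp: prolongation_def restriction_def scalar_prod_def lessThan_atLeast0 intro!: sum.cong)

lemma prolongation_odd:
  assumes w: "w \<in> carrier_vec (2 ^ (J - 1) - 1)" and i: "i < 2 ^ (J - 1) - 1" and J: "1 \<le> J"
  shows "(prolongation J *\<^sub>v w) $ (2 * i + 1) = w $ i"
proof -
  have k: "2 * i + 1 < 2 ^ J - 1" using i J by (cases J) auto
  have "(prolongation J *\<^sub>v w) $ (2 * i + 1) = (\<Sum>l<2 ^ (J - 1) - 1. if l = i then w $ l else 0)"
    unfolding prolongation_apply[OF w k] by (intro sum.cong refl) auto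
  then show ?thesis using i by simp
qed

lemma prolongation_first:
  assumes w: "w \<in> carrier_vec (2 ^ (J - 1) - 1)" and J: "2 \<le> J"
  shows "(prolongation J *\<^sub>v w) $ 0 = w $ 0 / 2"
proof -
  have pos: "(0::nat) < 2 ^ (J - 1) - 1" "(0::nat) < 2 ^ J - 1"
    using J one_less_power[of "2::nat" "J - 1"] one_less_power[of "2::nat" J] by simp_all
  have "(prolongation J *\<^sub>v w) $ 0 = (\<Sum>l<2 ^ (J - 1) - 1. if l = 0 then w $ l / 2 else 0)"
    unfolding prolongation_apply[OF w pos(2)] by (intro sum.cong) auto
  then show ?thesis using pos by simp
qed

text \<open>At the last even index the right neighbour is the boundary point, hence the value 0 in
  the \<open>else\<close> branch.\<close>

lemma prolongation_even:
  assumes w: "w \<in> carrier_vec (2 ^ (J - 1) - 1)" and i: "i < 2 ^ (J - 1) - 1" and J: "1 \<le> J"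
  shows "(prolongation J *\<^sub>v w) $ (2 * i + 2)
    = (w $ i + (if i + 1 < 2 ^ (J - 1) - 1 then w $ (i + 1) else 0)) / 2"
proof -
  have k: "2 * i + 2 < 2 ^ J - 1" using i J by (cases J) auto
  have "(prolongation J *\<^sub>v w) $ (2 * i + 2)
      = (\<Sum>l<2 ^ (J - 1) - 1. (if l = i then w $ l / 2 else 0) + (if l = i + 1 then w $ l / 2 else 0))"
    unfolding prolongation_apply[OF w k] by (intro sum.cong refl) auto
  then show ?thesis using i by (simp add: sum.distrib add_divide_distrib)
qed

section \<open>Smoothing property and abstract two-grid estimate\<close>

lemma jacobi_smoothing:
  assumes A: "A \<in> carrier_mat N N" and sym: "A\<^sup>T = A"
    and diag: "\<And>i. i < N \<Longrightarrow> A $$ (i, i) = a0" and a0: "a0 > 0"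
    and nonneg: "\<And>v. v \<in> carrier_vec N \<Longrightarrow> 0 \<le> (A *\<^sub>v v) \<bullet> v"
    and upper: "\<And>v. v \<in> carrier_vec N \<Longrightarrow> (A *\<^sub>v v) \<bullet> v \<le> 2 * a0 * (v \<bullet> v)"
    and \<eta>: "\<eta> \<le> 2 * \<omega> * (1 - \<omega>)"
    and v: "v \<in> carrier_vec N"
  shows "(vec_norm A (damped_jacobi \<omega> A *\<^sub>v v))\<^sup>2
    \<le> (vec_norm A v)\<^sup>2 - \<eta> * (vec_norm (inv_mat (diag_part A)) (A *\<^sub>v v))\<^sup>2"
proof -
  define u where "u = A *\<^sub>v v"
  define s where "s = \<omega> / a0"
  have u: "u \<in> carrier_vec N" using A v by (simp add: u_def)
  have Au: "A *\<^sub>v u \<in> carrier_vec N" using A u by simp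
  have uu: "0 \<le> u \<bullet> u" by (simp add: scalar_prod_def sum_nonneg)
  have inv: "inv_mat (diag_part A) = (1 / a0) \<cdot>\<^sub>m 1\<^sub>m N"
    using inv_diag_part[OF A diag] a0 by simp
  have "damped_jacobi \<omega> A = 1\<^sub>m N - s \<cdot>\<^sub>m A"
    using A by (simp add: damped_jacobi_def inv s_def mult_smult_assoc_mat[where n = N and nc = N])
      (auto intro!: eq_matI)
  then have K: "damped_jacobi \<omega> A *\<^sub>v v = v - s \<cdot>\<^sub>v u"
    using A v by (simp add: minus_mult_distrib_mat_vec[where nr = N and nc = N] u_def
        smult_mat_mult_vec)
  have Kv: "v - s \<cdot>\<^sub>v u \<in> carrier_vec N" using v u by simp
  have "A *\<^sub>v (v - s \<cdot>\<^sub>v u) = u - s \<cdot>\<^sub>v (A *\<^sub>v u)"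
    using A v u by (simp add: mult_minus_distrib_mat_vec[where nr = N and nc = N]
        mult_mat_vec[where nr = N and nc = N] u_def)
  then have "(A *\<^sub>v (v - s \<cdot>\<^sub>v u)) \<bullet> (v - s \<cdot>\<^sub>v u)
      = u \<bullet> v - s * (u \<bullet> u) - s * ((A *\<^sub>v u) \<bullet> v) + s\<^sup>2 * ((A *\<^sub>v u) \<bullet> u)"
    using v u Au
    by (simp add: minus_scalar_prod_distrib[where n = N] scalar_prod_minus_distrib[where n = N]
        power2_eq_square algebra_simps)
  also have "(A *\<^sub>v u) \<bullet> v = u \<bullet> u"
    using transpose_vec_mult_scalar[OF A v u] by (simp add: sym u_def)
  \<comment> \<open>The spectral bound \<open>upper\<close> is applied to \<open>u = A v\<close>
    itself. With \<open>s = \<omega> / a0\<close> the coefficients of \<open>u \<bullet> u\<close>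
    then combine to \<open>- 2 * \<omega> * (1 - \<omega>) / a0\<close>.\<close>
  also have "u \<bullet> v - s * (u \<bullet> u) - s * (u \<bullet> u) + s\<^sup>2 * ((A *\<^sub>v u) \<bullet> u)
      \<le> u \<bullet> v - s * (u \<bullet> u) - s * (u \<bullet> u) + s\<^sup>2 * (2 * a0 * (u \<bullet> u))"
    by (intro add_left_mono mult_left_mono upper u) simp
  also have "\<dots> = u \<bullet> v - (2 * \<omega> * (1 - \<omega>)) / a0 * (u \<bullet> u)"
    using a0 by (simp add: s_def power2_eq_square field_simps)
  also have "\<dots> \<le> u \<bullet> v - \<eta> / a0 * (u \<bullet> u)"
    using \<eta> a0 uu by (intro diff_left_mono mult_right_mono divide_right_mono) auto
  finally have "(A *\<^sub>v (v - s \<cdot>\<^sub>v u)) \<bullet> (v - s \<cdot>\<^sub>v u) \<le> u \<bullet> v - \<eta> / a0 * (u \<bullet> u)" .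
  then show ?thesis
    unfolding vec_norm_def K inv
    using nonneg[OF v] nonneg[OF Kv] uu a0 u by (simp add: u_def[symmetric] smult_mat_mult_vec[where nr = N and nc = N])
qed

text \<open>Coarse-grid correction does not increase the energy and leaves a residual orthogonal to
  the range of the prolongation. Through \<open>approx\<close> this makes the residual large
  relative to the energy, so the smoother removes at least the fraction
  \<open>\<eta> / C\<close>.\<close>

lemma two_grid_bound:
  assumes J: "2 \<le> J" and A: "A \<in> carrier_mat (2 ^ J - 1) (2 ^ J - 1)" and sym: "A\<^sup>T = A"
    and diag: "\<And>i. i < 2 ^ J - 1 \<Longrightarrow> A $$ (i, i) = a0" and a0: "a0 > 0"
    and pos: "\<And>v. v \<in> carrier_vec (2 ^ J - 1) \<Longrightarrow> v \<noteq> 0\<^sub>v (2 ^ J - 1) \<Longrightarrow> 0 < (A *\<^sub>v v) \<bullet> v"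
    and upper: "\<And>v. v \<in> carrier_vec (2 ^ J - 1) \<Longrightarrow> (A *\<^sub>v v) \<bullet> v \<le> 2 * a0 * (v \<bullet> v)"
    and approx: "\<And>e. e \<in> carrier_vec (2 ^ J - 1) \<Longrightarrow>
      \<exists>w \<in> carrier_vec (2 ^ (J - 1) - 1).
        a0 * ((e - prolongation J *\<^sub>v w) \<bullet> (e - prolongation J *\<^sub>v w)) \<le> C * ((A *\<^sub>v e) \<bullet> e)"
    and C: "1 \<le> C" and \<eta>: "0 < \<eta>" "\<eta> \<le> 2 * \<omega> * (1 - \<omega>)"
  shows "mat_norm A (damped_jacobi \<omega> A * coarse_correction J A) \<le> sqrt (1 - \<eta> / C)"
proof -
  define N n :: nat where "N = 2 ^ J - 1" and "n = 2 ^ (J - 1) - 1"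
  define R P M T K where "R = restriction J" and "P = prolongation J"
    and "M = inv_mat (coarse_matrix J A)" and "T = coarse_correction J A" and "K = damped_jacobi \<omega> A"
  note A = A[folded N_def] and diag = diag[folded N_def] and pos = pos[folded N_def]
    and upper = upper[folded N_def] and approx = approx[folded N_def n_def P_def]
  have R: "R \<in> carrier_mat n N" and P: "P \<in> carrier_mat N n"
    using restriction_carrier[of J] prolongation_carrier[of J]
    by (simp_all add: R_def P_def N_def n_def)
  have PR: "(P *\<^sub>v w) \<bullet> v = 2 * (w \<bullet> (R *\<^sub>v v))" if "w \<in> carrier_vec n" "v \<in> carrier_vec N" for v w
  proof -
    have "P *\<^sub>v w = 2 \<cdot>\<^sub>v (R\<^sup>T *\<^sub>v w)"
      using R that by (simp add: P_def prolongation_def R_def smult_mat_mult_vec)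
    then show ?thesis
      using R that transpose_vec_mult_scalar[OF R that(2,1)] by simp
  qed
  have mat_dim: "R * A * P \<in> carrier_mat n n" using R A P by simp
  have RAP: "(R * A * P) *\<^sub>v w = R *\<^sub>v (A *\<^sub>v (P *\<^sub>v w))" if w: "w \<in> carrier_vec n" for w
  proof -
    have "(R * A * P) *\<^sub>v w = (R * A) *\<^sub>v (P *\<^sub>v w)"
      using R A P w by (intro assoc_mult_mat_vec) auto
    also have "\<dots> = R *\<^sub>v (A *\<^sub>v (P *\<^sub>v w))"
      using R A P w by (intro assoc_mult_mat_vec) auto
    finally show ?thesis .
  qed
  \<comment> \<open>On a kernel vector \<open>w\<close> the energy of \<open>P w\<close> equals
    twice the product of \<open>w\<close> with its image under the coarse matrix, hence 0. So
    \<open>P w = 0\<close>, and the odd entries of \<open>P w\<close> are those of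
    \<open>w\<close>.\<close>
  have Minj: "w = 0\<^sub>v n" if w: "w \<in> carrier_vec n" and "(R * A * P) *\<^sub>v w = 0\<^sub>v n" for w
  proof (rule ccontr)
    assume "w \<noteq> 0\<^sub>v n"
    have Pw: "P *\<^sub>v w \<in> carrier_vec N" using P w by simp
    have "P *\<^sub>v w \<noteq> 0\<^sub>v N"
    proof
      assume z: "P *\<^sub>v w = 0\<^sub>v N"
      have "w $ i = 0" if "i < n" for i
        using prolongation_odd[of w J i] J w that z unfolding P_def n_def N_def
        by (cases J) auto
      then have "w = 0\<^sub>v n" using w by (intro eq_vecI) auto
      with \<open>w \<noteq> 0\<^sub>v n\<close> show False ..
    qed
    then have "0 < (A *\<^sub>v (P *\<^sub>v w)) \<bullet> (P *\<^sub>v w)" using pos Pw by blast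
    also have "\<dots> = (P *\<^sub>v w) \<bullet> (A *\<^sub>v (P *\<^sub>v w))"
      using A Pw by (intro comm_scalar_prod[where n = N]) auto
    also have "\<dots> = 2 * (w \<bullet> ((R * A * P) *\<^sub>v w))"
      using PR[OF w, of "A *\<^sub>v (P *\<^sub>v w)"] A Pw by (simp add: RAP[OF w] del: assoc_mult_mat)
    also have "\<dots> = 0" using that by simp
    finally show False by simp
  qed
  have M: "M \<in> carrier_mat n n" "(R * A * P) * M = 1\<^sub>m n"
    using inv_mat_of_injective[OF mat_dim Minj] by (simp_all add: M_def coarse_matrix_def R_def P_def)
  have T: "T = 1\<^sub>m N - P * M * R * A"
    by (simp add: T_def coarse_correction_def P_def M_def R_def N_def)
  have T_carrier: "T \<in> carrier_mat N N" using P M(1) R A unfolding T by (auto simp del: assoc_mult_mat)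
  have K_carrier: "K \<in> carrier_mat N N"
    using A a0 by (auto simp: K_def damped_jacobi_def inv_diag_part[OF A diag]
        intro!: minus_carrier_mat smult_carrier_mat mult_carrier_mat[of _ N N])
  have energy_nonneg: "0 \<le> (A *\<^sub>v v) \<bullet> v" if "v \<in> carrier_vec N" for v
    using pos[OF that] A that by (cases "v = 0\<^sub>v N") auto
  have "0 < N" using J one_less_power[of "2::nat" J] by (simp add: N_def)
  \<comment> \<open>Since \<open>(2 * \<omega> - 1)\<^sup>2 \<ge> 0\<close>, even
    \<open>\<eta> \<le> 1 / 2\<close> holds. This keeps \<open>1 - \<eta> / C\<close> nonnegative,
    as needed when multiplying by it below.\<close>
  have "\<eta> \<le> 1"
    using \<eta>(2) zero_le_power2[of "2 * \<omega> - 1"] by (simp add: power2_eq_square algebra_simps)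
  then have "\<eta> / C \<le> 1" using C by simp
  have bound: "(A *\<^sub>v (K *\<^sub>v (T *\<^sub>v v))) \<bullet> (K *\<^sub>v (T *\<^sub>v v)) \<le> (1 - \<eta> / C) * ((A *\<^sub>v v) \<bullet> v)"
    if v: "v \<in> carrier_vec N" for v
  proof -
    define e z u where "e = T *\<^sub>v v" and "z = M *\<^sub>v (R *\<^sub>v (A *\<^sub>v v))" and "u = A *\<^sub>v e"
    have Av: "A *\<^sub>v v \<in> carrier_vec N" and z: "z \<in> carrier_vec n" and Pz: "P *\<^sub>v z \<in> carrier_vec N"
      and e: "e \<in> carrier_vec N" and u: "u \<in> carrier_vec N"
      using A v T_carrier P M(1) R by (simp_all add: z_def e_def u_def)
    have RAv: "R *\<^sub>v (A *\<^sub>v v) \<in> carrier_vec n" using R Av by simp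
    have "(P * M * R * A) *\<^sub>v v = (P * M * R) *\<^sub>v (A *\<^sub>v v)"
      using P M(1) R A v by (intro assoc_mult_mat_vec) auto
    also have "\<dots> = (P * M) *\<^sub>v (R *\<^sub>v (A *\<^sub>v v))"
      using P M(1) R Av by (intro assoc_mult_mat_vec) auto
    also have "\<dots> = P *\<^sub>v z"
      unfolding z_def using P M(1) RAv by (intro assoc_mult_mat_vec) auto
    finally have PMRA: "(P * M * R * A) *\<^sub>v v = P *\<^sub>v z" .
    have "e = 1\<^sub>m N *\<^sub>v v - (P * M * R * A) *\<^sub>v v"
      unfolding e_def T using P M(1) R A v by (intro minus_mult_distrib_mat_vec) auto
    then have e_eq: "e = v - P *\<^sub>v z" using v by (simp only: PMRA one_mult_mat_vec)
    have "R *\<^sub>v (A *\<^sub>v (P *\<^sub>v z)) = (R * A * P) *\<^sub>v z"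
      by (rule RAP[OF z, symmetric])
    also have "\<dots> = ((R * A * P) * M) *\<^sub>v (R *\<^sub>v (A *\<^sub>v v))"
      unfolding z_def using mat_dim M(1) RAv by (intro assoc_mult_mat_vec[symmetric]) auto
    finally have "R *\<^sub>v (A *\<^sub>v (P *\<^sub>v z)) = ((R * A * P) * M) *\<^sub>v (R *\<^sub>v (A *\<^sub>v v))" .
    then have "R *\<^sub>v (A *\<^sub>v (P *\<^sub>v z)) = R *\<^sub>v (A *\<^sub>v v)" using RAv by (simp only: M(2) one_mult_mat_vec)
    \<comment> \<open>Galerkin orthogonality: the restriction annihilates the residual
      \<open>u = A e\<close>, so \<open>u\<close> is orthogonal to the range of
      \<open>P\<close>.\<close>
    then have Ru: "R *\<^sub>v u = 0\<^sub>v n"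
      using R A v Pz Av by (simp add: u_def e_eq mult_minus_distrib_mat_vec[where nr = N and nc = N]
          mult_minus_distrib_mat_vec[where nr = n and nc = N])
    have orth: "u \<bullet> (P *\<^sub>v w) = 0" if "w \<in> carrier_vec n" for w
      using PR[OF that u] P that u by (simp add: Ru comm_scalar_prod[where n = N])
    have v_eq: "v = e + P *\<^sub>v z" unfolding e_eq using v P by (intro eq_vecI) auto
    have "(A *\<^sub>v v) \<bullet> v = (u + A *\<^sub>v (P *\<^sub>v z)) \<bullet> (e + P *\<^sub>v z)"
      using A e Pz by (simp add: v_eq u_def mult_add_distrib_mat_vec[where nr = N and nc = N])
    also have "\<dots> = u \<bullet> e + u \<bullet> (P *\<^sub>v z) + (A *\<^sub>v (P *\<^sub>v z)) \<bullet> e + (A *\<^sub>v (P *\<^sub>v z)) \<bullet> (P *\<^sub>v z)"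
      using A e Pz u
      by (simp add: add_scalar_prod_distrib[where n = N] scalar_prod_add_distrib[where n = N])
    also have "(A *\<^sub>v (P *\<^sub>v z)) \<bullet> e = (P *\<^sub>v z) \<bullet> u"
      using transpose_vec_mult_scalar[OF A e Pz] by (simp add: sym u_def)
    also have "(P *\<^sub>v z) \<bullet> u = u \<bullet> (P *\<^sub>v z)"
      using u Pz by (rule comm_scalar_prod[symmetric])
    \<comment> \<open>Pythagoras in the energy inner product: \<open>v = e + P z\<close> with both
      mixed terms zero.\<close>
    finally have contraction: "u \<bullet> e \<le> (A *\<^sub>v v) \<bullet> v"
      using energy_nonneg[OF Pz] by (simp add: orth[OF z])
    obtain w where w: "w \<in> carrier_vec n"
      and appr: "a0 * ((e - P *\<^sub>v w) \<bullet> (e - P *\<^sub>v w)) \<le> C * (u \<bullet> e)"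
      using approx[OF e] by (auto simp: u_def)
    define f where "f = e - P *\<^sub>v w"
    have Pw: "P *\<^sub>v w \<in> carrier_vec N" and f: "f \<in> carrier_vec N"
      using P w e by (simp_all add: f_def)
    have uf: "u \<bullet> f = u \<bullet> e"
      using u e Pw by (simp add: f_def scalar_prod_minus_distrib[where n = N] orth[OF w])
    \<comment> \<open>This choice replaces Cauchy-Schwarz: \<open>appr\<close> becomes
      \<open>t * (f \<bullet> f) \<le> u \<bullet> e\<close>, and expanding the square of
      \<open>u - t f\<close> with \<open>u \<bullet> f = u \<bullet> e\<close> leaves
      \<open>t * (u \<bullet> e) \<le> u \<bullet> u\<close>.\<close>
    define t where "t = a0 / C"
    have t: "0 < t" using a0 C by (simp add: t_def)
    have "0 \<le> (u - t \<cdot>\<^sub>v f) \<bullet> (u - t \<cdot>\<^sub>v f)"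
      by (simp add: scalar_prod_def sum_nonneg)
    also have "\<dots> = u \<bullet> u - 2 * t * (u \<bullet> f) + t * (t * (f \<bullet> f))"
      using u f by (simp add: minus_scalar_prod_distrib[where n = N]
          scalar_prod_minus_distrib[where n = N] comm_scalar_prod[OF f u] algebra_simps)
    also have "t * (f \<bullet> f) \<le> u \<bullet> e"
      using appr C by (simp add: f_def t_def field_simps)
    then have "u \<bullet> u - 2 * t * (u \<bullet> f) + t * (t * (f \<bullet> f)) \<le> u \<bullet> u - t * (u \<bullet> e)"
      using mult_left_mono[of "t * (f \<bullet> f)" "u \<bullet> e" t] t by (simp add: uf)
    finally have "t * (u \<bullet> e) \<le> u \<bullet> u" by simp
    then have approx_e: "(u \<bullet> e) / C \<le> (u \<bullet> u) / a0"
      using a0 C by (simp add: t_def field_simps)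
    have uu: "0 \<le> u \<bullet> u" by (simp add: scalar_prod_def sum_nonneg)
    have Ke: "K *\<^sub>v e \<in> carrier_vec N" using K_carrier e by simp
    have "(vec_norm A (K *\<^sub>v e))\<^sup>2 \<le> (vec_norm A e)\<^sup>2 - \<eta> * (vec_norm (inv_mat (diag_part A)) (A *\<^sub>v e))\<^sup>2"
      unfolding K_def
      by (rule jacobi_smoothing[OF A sym diag a0 energy_nonneg upper \<eta>(2) e])
    then have "(A *\<^sub>v (K *\<^sub>v e)) \<bullet> (K *\<^sub>v e) \<le> u \<bullet> e - \<eta> * ((u \<bullet> u) / a0)"
      using energy_nonneg[OF e] energy_nonneg[OF Ke] a0 u
      by (simp add: vec_norm_def inv_diag_part[OF A diag] u_def[symmetric] uu
          smult_mat_mult_vec[where nr = N and nc = N])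
    also have "\<dots> \<le> u \<bullet> e - \<eta> * ((u \<bullet> e) / C)"
      using approx_e \<eta>(1) by (intro diff_left_mono mult_left_mono) auto
    also have "\<dots> = (1 - \<eta> / C) * (u \<bullet> e)" by (simp add: algebra_simps)
    also have "\<dots> \<le> (1 - \<eta> / C) * ((A *\<^sub>v v) \<bullet> v)"
      using contraction \<open>\<eta> / C \<le> 1\<close> by (intro mult_left_mono) auto
    finally show ?thesis by (simp add: e_def)
  qed
  \<comment> \<open>A supremum in the reals is bounded by its upper bounds only if the set is
    nonempty.\<close>
  have "(unit_vec N 0 :: real vec) $ 0 \<noteq> 0\<^sub>v N $ 0" using \<open>0 < N\<close> by simp
  then have "(unit_vec N 0 :: real vec) \<in> carrier_vec N - {0\<^sub>v N}" by auto
  then have "carrier_vec N - {0\<^sub>v N :: real vec} \<noteq> {}" by blast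
  moreover have "vec_norm A ((K * T) *\<^sub>v v) / vec_norm A v \<le> sqrt (1 - \<eta> / C)"
    if "v \<in> carrier_vec N - {0\<^sub>v N}" for v
  proof -
    have v: "v \<in> carrier_vec N" and "0 < (A *\<^sub>v v) \<bullet> v" using that pos by auto
    then have "((A *\<^sub>v (K *\<^sub>v (T *\<^sub>v v))) \<bullet> (K *\<^sub>v (T *\<^sub>v v))) / ((A *\<^sub>v v) \<bullet> v) \<le> 1 - \<eta> / C"
      using bound[OF v] by (simp add: pos_divide_le_eq)
    then show ?thesis
      using K_carrier T_carrier v by (simp add: vec_norm_def real_sqrt_divide[symmetric])
  qed
  ultimately show ?thesis
    unfolding mat_norm_def K_def[symmetric] T_def[symmetric] carrier_matD(1)[OF A]
    by (rule cSUP_least)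
qed

subsection \<open>The stiffness coefficients\<close>

lemma offdiag_coeff_small:
  assumes "\<delta> / h \<le> 1"
  shows "offdiag_coeff h \<delta> k = (if k = 1 then - 1 / h\<^sup>2 else 0)"
  using assms by (simp add: offdiag_coeff_def Let_def)

lemma offdiag_coeff_zero:
  assumes "\<delta> / h > 1" and "nat \<lfloor>\<delta> / h\<rfloor> + 1 < k"
  shows "offdiag_coeff h \<delta> k = 0"
  using assms by (simp add: offdiag_coeff_def Let_def)

text \<open>\<open>B\<close> and \<open>D\<close> are the coefficients \<open>-a\<^sub>r\<close> and \<open>-a\<^sub>r\<^sub>+\<^sub>1\<close> in units of \<open>3 / (h\<^sup>2 R\<^sup>3)\<close>, written in
  \<open>t = R - r\<close>.\<close>

lemma last_coeff_bounds:
  fixes r t :: real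
  assumes r: "1 \<le> r" and t: "0 \<le> t" "t < 1"
  defines "B \<equiv> (3 * r - 1 + t * (6 * r + 3 * t - t * (3 * r + 2 * t))) / (6 * r)"
    and "D \<equiv> t\<^sup>2 * (3 * r + 2 * t) / (6 * (r + 1))"
  shows "1 / 3 \<le> B" and "B \<le> 1" and "0 \<le> D" and "D \<le> 1 / 2" and "D \<le> B"
proof -
  define q where "q = 6 * r + 3 * t - t * (3 * r + 2 * t)"
  have B: "B = (3 * r - 1 + t * q) / (6 * r)" by (simp add: B_def q_def)
  have tt: "t * t \<le> t" "0 \<le> t * t" using t mult_left_mono[of t 1 t] by auto
  have "t * r \<le> r" using t r mult_right_mono[of t 1 r] by simp
  then have q: "q \<ge> 3 * r + t" using tt by (simp add: q_def algebra_simps)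
  have tq: "0 \<le> t * q" using q r t by simp
  show B3: "1 / 3 \<le> B"
    using r tq by (simp add: B field_simps)
  \<comment> \<open>\<open>B \<le> 1\<close> amounts to nonnegativity of this polynomial, which has
    a double zero at \<open>t = 1\<close>.\<close>
  have "1 + 3 * r - t * q = 3 * r * (1 - t)\<^sup>2 + (1 - t)\<^sup>2 * (1 + 2 * t)"
    by (simp add: q_def power2_eq_square algebra_simps)
  moreover have "0 \<le> 3 * r * (1 - t)\<^sup>2 + (1 - t)\<^sup>2 * (1 + 2 * t)"
    using r t by (intro add_nonneg_nonneg mult_nonneg_nonneg) auto
  ultimately have "t * q \<le> 1 + 3 * r" by linarith
  then show "B \<le> 1" using r by (simp add: B field_simps)
  show "0 \<le> D" using r t by (simp add: D_def)
  have "t\<^sup>2 \<le> t" using tt by (simp add: power2_eq_square)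
  then have "t\<^sup>2 * (3 * r + 2 * t) \<le> t * (3 * r + 2 * t)"
    using r t by (intro mult_right_mono) auto
  also have "\<dots> = 3 * (t * r) + 2 * (t * t)" by (simp add: algebra_simps)
  also have "\<dots> \<le> 3 * r + 2" using t tt \<open>t * r \<le> r\<close> by linarith
  finally show "D \<le> 1 / 2" using r by (simp add: D_def field_simps)
  show "D \<le> B"
  proof -
    have "t * (3 * r + 2 * t) \<le> t * q + 1"
    proof -
      have "t * t \<le> 1" using tt t by linarith
      have "t * (3 * r + 2 * t) \<le> t * (3 * r + t) + 1" using \<open>t * t \<le> 1\<close> by (simp add: algebra_simps)
      also have "t * (3 * r + t) \<le> t * q" using q t by (intro mult_left_mono) auto
      finally show ?thesis by simp
    qed
    then have num: "t\<^sup>2 * (3 * r + 2 * t) \<le> 3 * r - 1 + t * q"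
      using \<open>t\<^sup>2 * (3 * r + 2 * t) \<le> t * (3 * r + 2 * t)\<close> r by linarith
    have "D \<le> (3 * r - 1 + t * q) / (6 * (r + 1))"
      unfolding D_def using num r by (intro divide_right_mono) auto
    also have "\<dots> \<le> (3 * r - 1 + t * q) / (6 * r)"
      using r tq by (intro divide_left_mono) auto
    finally show ?thesis by (simp add: B)
  qed
qed

text \<open>In units of \<open>\<kappa>\<close> the coefficients have modulus 1 before index
  \<open>r\<close>, then \<open>B\<close> and \<open>D\<close>. Hiding these two rational
  expressions leaves only the bounds that the estimates below use.\<close>

lemma offdiag_coeff_large:
  assumes h: "h > 0" and R: "\<delta> / h > 1"
  defines "r \<equiv> nat \<lfloor>\<delta> / h\<rfloor>" and "\<kappa> \<equiv> 3 / (h\<^sup>2 * (\<delta> / h) ^ 3)"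
  obtains B D where "1 \<le> r" and "real r \<le> \<delta> / h" and "0 < \<kappa>"
    and "\<And>k. k < r \<Longrightarrow> offdiag_coeff h \<delta> k = - \<kappa>"
    and "offdiag_coeff h \<delta> r = - (\<kappa> * B)"
    and "offdiag_coeff h \<delta> (r + 1) = - (\<kappa> * D)"
    and "1 / 3 \<le> B" and "B \<le> 1" and "0 \<le> D" and "D \<le> 1 / 2" and "D \<le> B"
proof -
  define R' t where "R' = \<delta> / h" and "t = R' - real r"
  define B D where "B = (3 * real r - 1 + t * (6 * real r + 3 * t - t * (3 * real r + 2 * t))) / (6 * real r)"
    and "D = t\<^sup>2 * (3 * real r + 2 * t) / (6 * (real r + 1))"
  have R'1: "R' > 1" and r': "r = nat \<lfloor>R'\<rfloor>" and \<kappa>: "\<kappa> = 3 / (h\<^sup>2 * R' ^ 3)"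
    using R by (simp_all add: r_def R'_def \<kappa>_def)
  have r: "1 \<le> r" using R'1 by (simp add: r' le_nat_iff le_floor_iff)
  then have r1: "1 \<le> real r" by simp
  have t01: "0 \<le> t" "t < 1" using R'1 by (simp_all add: t_def r') linarith
  have \<kappa>0: "0 < \<kappa>" using h R'1 by (simp add: \<kappa>)
  have R'_eq: "R' = real r + t" by (simp add: t_def)
  have pos: "h\<^sup>2 * R' ^ 3 > 0" using h R'1 by simp
  note unfold = offdiag_coeff_def Let_def R'_def[symmetric] r'[symmetric]
  have num: "3 * real r - 1
        + (R' - real r) * ((real r)\<^sup>2 + real r * R' - 2 * R'\<^sup>2 + 3 * real r + 3 * R')
      = 3 * real r - 1 + t * (6 * real r + 3 * t - t * (3 * real r + 2 * t))"
    by (simp add: R'_eq power2_eq_square algebra_simps)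
  have "offdiag_coeff h \<delta> r
      = - (3 * real r - 1
          + (R' - real r) * ((real r)\<^sup>2 + real r * R' - 2 * R'\<^sup>2 + 3 * real r + 3 * R'))
          / (2 * h\<^sup>2 * R' ^ 3 * real r)"
    using R'1 by (simp add: unfold)
  also have "\<dots> = - (\<kappa> * B)"
    unfolding num \<kappa> B_def using pos r by (simp add: divide_simps)
  finally have mid: "offdiag_coeff h \<delta> r = - (\<kappa> * B)" .
  have num: "(R' - real r) * (2 * R'\<^sup>2 - real r * R' - (real r)\<^sup>2) = t\<^sup>2 * (3 * real r + 2 * t)"
    by (simp add: R'_eq power2_eq_square algebra_simps)
  have "offdiag_coeff h \<delta> (r + 1)
      = - ((R' - real r) * (2 * R'\<^sup>2 - real r * R' - (real r)\<^sup>2)) / (2 * h\<^sup>2 * R' ^ 3 * (real r + 1))"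
    using R'1 by (simp add: unfold)
  also have "\<dots> = - (\<kappa> * D)"
    unfolding num \<kappa> D_def using pos r by (simp add: divide_simps)
  finally have last: "offdiag_coeff h \<delta> (r + 1) = - (\<kappa> * D)" .
  show ?thesis
  proof (rule that[OF r _ \<kappa>0 _ mid last last_coeff_bounds[OF r1 t01, folded B_def D_def]])
    show "real r \<le> \<delta> / h" using t01 by (simp add: t_def R'_def)
    show "offdiag_coeff h \<delta> k = - \<kappa>" if "k < r" for k
      using that R'1 by (simp add: unfold \<kappa>)
  qed
qed

section \<open>Signs and sums of the coefficients\<close>

lemma offdiag_coeff_nonpos:
  assumes h: "h > 0" and k: "1 \<le> k"
  shows "offdiag_coeff h \<delta> k \<le> 0"
proof (cases "\<delta> / h \<le> 1")
  case True
  then show ?thesis using h by (simp add: offdiag_coeff_small)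
next
  case False
  then have R: "\<delta> / h > 1" by simp
  define r \<kappa> where "r = nat \<lfloor>\<delta> / h\<rfloor>" and "\<kappa> = 3 / (h\<^sup>2 * (\<delta> / h) ^ 3)"
  obtain B D where c: "0 < \<kappa>" "\<And>k. k < r \<Longrightarrow> offdiag_coeff h \<delta> k = - \<kappa>"
    "offdiag_coeff h \<delta> r = - (\<kappa> * B)" "offdiag_coeff h \<delta> (r + 1) = - (\<kappa> * D)"
    "1 / 3 \<le> B" "0 \<le> D"
    by (rule offdiag_coeff_large[OF h R, folded r_def \<kappa>_def]) blast
  consider "k < r" | "k = r" | "k = r + 1" | "r + 1 < k" by linarith
  then show ?thesis
    by cases (use c offdiag_coeff_zero[OF R] in \<open>auto simp: r_def mult_nonneg_nonneg\<close>)
qed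

text \<open>For \<open>r = 1\<close> the first coefficient is already the exceptional one,
  \<open>- (\<kappa> * B)\<close>, and the lower bound on \<open>B\<close> is needed. Strictness is
  what makes the energy positive definite.\<close>

lemma first_coeff_neg:
  assumes h: "h > 0"
  shows "offdiag_coeff h \<delta> 1 < 0"
proof (cases "\<delta> / h \<le> 1")
  case True
  then show ?thesis using h by (simp add: offdiag_coeff_small)
next
  case False
  then have R: "\<delta> / h > 1" by simp
  define r \<kappa> where "r = nat \<lfloor>\<delta> / h\<rfloor>" and "\<kappa> = 3 / (h\<^sup>2 * (\<delta> / h) ^ 3)"
  obtain B where c: "1 \<le> r" "0 < \<kappa>" "\<And>k. k < r \<Longrightarrow> offdiag_coeff h \<delta> k = - \<kappa>"
    "offdiag_coeff h \<delta> r = - (\<kappa> * B)" "1 / 3 \<le> B"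
    by (rule offdiag_coeff_large[OF h R, folded r_def \<kappa>_def]) blast
  have "0 < \<kappa> * B" using c by simp
  with c show ?thesis by (cases "r = 1") auto
qed

text \<open>There are \<open>r - 1\<close> full weights, followed by \<open>B \<le> 1\<close> and
  \<open>D \<le> 1 / 2\<close>.\<close>

lemma offdiag_sum_le:
  assumes h: "h > 0" and R: "\<delta> / h > 1"
  defines "r \<equiv> nat \<lfloor>\<delta> / h\<rfloor>" and "\<kappa> \<equiv> 3 / (h\<^sup>2 * (\<delta> / h) ^ 3)"
  shows "(\<Sum>p = 1..r + 1. - offdiag_coeff h \<delta> p) \<le> \<kappa> * (real r + 1 / 2)"
proof -
  obtain B D where c: "1 \<le> r" "0 < \<kappa>" "\<And>k. k < r \<Longrightarrow> offdiag_coeff h \<delta> k = - \<kappa>"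
    "offdiag_coeff h \<delta> r = - (\<kappa> * B)" "offdiag_coeff h \<delta> (r + 1) = - (\<kappa> * D)"
    "B \<le> 1" "D \<le> 1 / 2"
    by (rule offdiag_coeff_large[OF h R, folded r_def \<kappa>_def]) blast
  obtain m where m: "r = Suc m" using c(1) by (cases r) auto
  have "(\<Sum>p = 1..m. - offdiag_coeff h \<delta> p) = (\<Sum>p = 1..m. \<kappa>)"
    using c(3) by (intro sum.cong) (auto simp: m)
  then have "(\<Sum>p = 1..r + 1. - offdiag_coeff h \<delta> p) = real m * \<kappa> + \<kappa> * B + \<kappa> * D"
    using c(4,5) by (simp add: m)
  also have "\<dots> \<le> real m * \<kappa> + \<kappa> * 1 + \<kappa> * (1 / 2)"
    using c by (intro add_mono mult_left_mono) auto
  also have "\<dots> = \<kappa> * (real r + 1 / 2)" by (simp add: m algebra_simps)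
  finally show ?thesis .
qed

text \<open>For \<open>r = 1\<close> the sum has two terms, the second at most the first as
  \<open>D \<le> B\<close>, and \<open>R > 1\<close>. For \<open>r \<ge> 2\<close> the first
  coefficient is \<open>- \<kappa>\<close> and \<open>r + 1 / 2 \<le> 2 * R\<close>.\<close>

lemma offdiag_sum_le_first:
  assumes h: "h > 0" and R: "\<delta> / h > 1"
  shows "(\<Sum>p = 1..nat \<lfloor>\<delta> / h\<rfloor> + 1. - offdiag_coeff h \<delta> p) \<le> 2 * (\<delta> / h) * - offdiag_coeff h \<delta> 1"
proof -
  define r \<kappa> where "r = nat \<lfloor>\<delta> / h\<rfloor>" and "\<kappa> = 3 / (h\<^sup>2 * (\<delta> / h) ^ 3)"
  obtain B D where c: "1 \<le> r" "real r \<le> \<delta> / h" "0 < \<kappa>"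
    "\<And>k. k < r \<Longrightarrow> offdiag_coeff h \<delta> k = - \<kappa>"
    "offdiag_coeff h \<delta> r = - (\<kappa> * B)" "offdiag_coeff h \<delta> (r + 1) = - (\<kappa> * D)" "D \<le> B"
    by (rule offdiag_coeff_large[OF h R, folded r_def \<kappa>_def]) blast
  have "(\<Sum>p = 1..r + 1. - offdiag_coeff h \<delta> p) \<le> 2 * (\<delta> / h) * - offdiag_coeff h \<delta> 1"
  proof (cases "r = 1")
    case True
    have "\<kappa> * D \<le> \<kappa> * B" using c by (intro mult_left_mono) auto
    then have "(\<Sum>p = 1..r + 1. - offdiag_coeff h \<delta> p) \<le> 2 * - offdiag_coeff h \<delta> 1"
      using c(5,6) by (simp add: True numeral_2_eq_2 mult.commute)
    also have "\<dots> \<le> 2 * (\<delta> / h) * - offdiag_coeff h \<delta> 1"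
      using R first_coeff_neg[OF h, of \<delta>] by (intro mult_right_mono) auto
    finally show ?thesis .
  next
    case False
    then have r1: "1 < r" using c(1) by simp
    have "(\<Sum>p = 1..r + 1. - offdiag_coeff h \<delta> p) \<le> \<kappa> * (real r + 1 / 2)"
      using offdiag_sum_le[OF h R] by (simp add: r_def \<kappa>_def)
    also have "\<dots> \<le> \<kappa> * (2 * (\<delta> / h))"
      using c(2,3) r1 by (intro mult_left_mono) auto
    also have "\<dots> = 2 * (\<delta> / h) * - offdiag_coeff h \<delta> 1"
      using c(4)[OF r1] by simp
    finally show ?thesis .
  qed
  then show ?thesis by (simp add: r_def)
qed

lemma stiffness_coeff_diag:
  assumes h: "h > 0" and L: "nat \<lfloor>\<delta> / h\<rfloor> + 1 \<le> L"
  shows "stiffness_coeff h \<delta> 0 = - 2 * (\<Sum>p = 1..L. stiffness_coeff h \<delta> p)"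
proof (cases "\<delta> / h \<le> 1")
  case True
  have "(\<Sum>p = 1..L. stiffness_coeff h \<delta> p) = (\<Sum>p = 1..L. if p = 1 then - 1 / h\<^sup>2 else 0)"
    by (intro sum.cong) (auto simp: stiffness_coeff_def offdiag_coeff_small[OF True])
  also have "\<dots> = - 1 / h\<^sup>2" using L by (subst sum.delta) auto
  finally show ?thesis using True by (simp add: stiffness_coeff_def)
next
  case False
  then have R: "\<delta> / h > 1" by simp
  have "(\<Sum>p = 1..L. stiffness_coeff h \<delta> p) = (\<Sum>p = 1..nat \<lfloor>\<delta> / h\<rfloor> + 1. offdiag_coeff h \<delta> p)"
    using L offdiag_coeff_zero[OF R] by (intro sum.mono_neutral_cong_right) (auto simp: stiffness_coeff_def)
  then show ?thesis using False by (simp add: stiffness_coeff_def)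
qed

subsection \<open>The stiffness matrix\<close>

definition zero_extend :: "real vec \<Rightarrow> nat \<Rightarrow> real" where
  "zero_extend v i = (if i < dim_vec v then v $ i else 0)"

lemma zero_extend_beyond: "dim_vec v \<le> i \<Longrightarrow> zero_extend v i = 0"
  by (simp add: zero_extend_def)

lemma sum_squares_zero_extend: "(\<Sum>i<dim_vec v. (zero_extend v i)\<^sup>2) = v \<bullet> v"
  by (simp add: scalar_prod_def zero_extend_def lessThan_atLeast0 power2_eq_square)

locale stiffness =
  fixes b \<delta> h :: real and N :: nat
  assumes b: "0 < b" and \<delta>: "0 < \<delta>" and N: "1 \<le> N" and h_def: "h = b / (real N + 1)"
begin

abbreviation "A \<equiv> stiffness_matrix b N \<delta>"
abbreviation "a \<equiv> stiffness_coeff h \<delta>"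
abbreviation "R \<equiv> \<delta> / h"

text \<open>Large enough both to reach every diagonal of the matrix and to include every nonzero
  coefficient in the formula for \<open>a 0\<close>.\<close>

definition L :: nat where "L = N + nat \<lfloor>R\<rfloor> + 1"

lemma L_ge: "1 \<le> L" "N \<le> L" "nat \<lfloor>R\<rfloor> + 1 \<le> L"
  by (simp_all add: L_def)

lemma h_pos: "0 < h"
  using b by (simp add: h_def)

lemma A_eq: "A = mat N N (\<lambda>(i, j). a (if i \<le> j then j - i else i - j))"
  by (simp add: stiffness_matrix_def h_def Let_def)

lemma A_carrier: "A \<in> carrier_mat N N"
  by (simp add: A_eq)

lemma A_sym: "A\<^sup>T = A"
  by (rule eq_matI) (auto simp: A_eq)

lemma A_diag: "i < N \<Longrightarrow> A $$ (i, i) = a 0"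
  by (simp add: A_eq)

lemma a_nonpos: "1 \<le> p \<Longrightarrow> a p \<le> 0"
  using offdiag_coeff_nonpos[OF h_pos] by (simp add: stiffness_coeff_def)

lemma a1_neg: "a 1 < 0"
  using first_coeff_neg[OF h_pos] by (simp add: stiffness_coeff_def)

lemma a0_eq: "a 0 = 2 * (\<Sum>p = 1..L. - a p)"
  using stiffness_coeff_diag[OF h_pos L_ge(3)] by (simp add: sum_negf)

section \<open>Bounds on the energy\<close>

lemma first_le_sum:
  assumes "\<And>p. 1 \<le> p \<Longrightarrow> 0 \<le> S p"
  shows "- a 1 * S 1 \<le> (\<Sum>p = 1..L. - a p * S p)"
  by (rule member_le_sum[of 1 "{1..L}" "\<lambda>p. - a p * S p"])
    (use assms a_nonpos L_ge in \<open>auto intro!: mult_nonpos_nonneg\<close>)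

lemma a0_pos: "0 < a 0"
  using first_le_sum[of "\<lambda>_. 1"] a1_neg by (simp add: a0_eq)

lemma energy_eq:
  assumes v: "v \<in> carrier_vec N"
  shows "(A *\<^sub>v v) \<bullet> v = (\<Sum>p = 1..L. - a p * shift_energy N (zero_extend v) p)"
proof -
  have "(A *\<^sub>v v) \<bullet> v
      = (\<Sum>i<N. \<Sum>j<N. a (if i \<le> j then j - i else i - j) * zero_extend v i * zero_extend v j)"
    using v by (simp add: A_eq scalar_prod_def lessThan_atLeast0 zero_extend_def sum_distrib_left
        sum_distrib_right mult_ac)
  also have "\<dots> = (\<Sum>p = 1..L. - a p * shift_energy N (zero_extend v) p)"
    using v by (intro toeplitz_energy zero_extend_beyond L_ge) (auto simp: a0_eq sum_negf)
  finally show ?thesis .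
qed

lemma energy_terms:
  assumes v: "v \<in> carrier_vec N"
  shows "0 \<le> shift_energy N (zero_extend v) p"
    and "shift_energy N (zero_extend v) p \<le> 4 * (v \<bullet> v)"
    and "\<lbrakk>1 \<le> p; p \<le> N\<rbrakk> \<Longrightarrow>
      (real p)\<^sup>2 * (v \<bullet> v) \<le> 4 * (real N + 1)\<^sup>2 * shift_energy N (zero_extend v) p"
proof -
  have dim: "dim_vec v = N" using v by simp
  have supp: "zero_extend v i = 0" if "N \<le> i" for i
    using that dim by (simp add: zero_extend_beyond)
  have sq: "(\<Sum>i<N. (zero_extend v i)\<^sup>2) = v \<bullet> v"
    using sum_squares_zero_extend[of v] by (simp add: dim)
  show "0 \<le> shift_energy N (zero_extend v) p"
    by (rule shift_energy_nonneg[where x = "zero_extend v" and N = N, OF supp])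
  show "shift_energy N (zero_extend v) p \<le> 4 * (v \<bullet> v)"
    using shift_energy_le[where x = "zero_extend v" and N = N, OF supp] by (simp add: sq)
  show "(real p)\<^sup>2 * (v \<bullet> v) \<le> 4 * (real N + 1)\<^sup>2 * shift_energy N (zero_extend v) p"
    if "1 \<le> p" "p \<le> N"
    using shift_poincare_scaled[where x = "zero_extend v" and N = N, OF supp that] by (simp add: sq)
qed

lemma energy_ge_first:
  assumes v: "v \<in> carrier_vec N"
  shows "- a 1 * shift_energy N (zero_extend v) 1 \<le> (A *\<^sub>v v) \<bullet> v"
  unfolding energy_eq[OF v] by (rule first_le_sum) (rule energy_terms[OF v])

text \<open>The Poincare inequality with step 1 makes the first shift energy positive, and its
  weight \<open>- a 1\<close> is positive too.\<close>

lemma energy_pos: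
  assumes v: "v \<in> carrier_vec N" and "v \<noteq> 0\<^sub>v N"
  shows "0 < (A *\<^sub>v v) \<bullet> v"
proof -
  obtain i where i: "i < N" "v $ i \<noteq> 0"
    using assms by (metis carrier_vecD eq_vecI index_zero_vec)
  have "0 < (v $ i)\<^sup>2" using i by simp
  also have "\<dots> \<le> v \<bullet> v"
    using i v member_le_sum[of i "{0..<N}" "\<lambda>i. v $ i * v $ i"]
    by (simp add: scalar_prod_def power2_eq_square)
  also have "\<dots> \<le> 4 * (real N + 1)\<^sup>2 * shift_energy N (zero_extend v) 1"
    using energy_terms(3)[OF v, of 1] N by simp
  finally have "0 < shift_energy N (zero_extend v) 1"
    using energy_terms(1)[OF v, of 1] by (cases "shift_energy N (zero_extend v) 1 = 0") auto
  then have "0 < - a 1 * shift_energy N (zero_extend v) 1"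
    using a1_neg by (intro mult_pos_pos) auto
  also have "\<dots> \<le> (A *\<^sub>v v) \<bullet> v" by (rule energy_ge_first[OF v])
  finally show ?thesis .
qed

text \<open>Each shift energy is at most \<open>4 * (v \<bullet> v)\<close>, and the weights
  \<open>- a p\<close> sum to half of \<open>a 0\<close>.\<close>

lemma energy_le:
  assumes v: "v \<in> carrier_vec N"
  shows "(A *\<^sub>v v) \<bullet> v \<le> 2 * a 0 * (v \<bullet> v)"
proof -
  have "(A *\<^sub>v v) \<bullet> v \<le> (\<Sum>p = 1..L. - a p * (4 * (v \<bullet> v)))"
    unfolding energy_eq[OF v] using a_nonpos energy_terms[OF v]
    by (intro sum_mono mult_left_mono) auto
  also have "\<dots> = 2 * a 0 * (v \<bullet> v)"
    by (simp only: a0_eq sum_distrib_right[symmetric])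
  finally show ?thesis .
qed

lemma energy_nonneg: "v \<in> carrier_vec N \<Longrightarrow> 0 \<le> (A *\<^sub>v v) \<bullet> v"
  unfolding energy_eq using a_nonpos energy_terms
  by (intro sum_nonneg mult_nonneg_nonneg) auto

section \<open>Two approximation properties\<close>

lemma coeff_sum_large:
  "(\<Sum>p = 1..L. - a p) = (\<Sum>p = 1..nat \<lfloor>R\<rfloor> + 1. - offdiag_coeff h \<delta> p)" if "1 < R"
  using that offdiag_coeff_zero L_ge(3) by (intro sum.mono_neutral_cong_right) (auto simp: stiffness_coeff_def)

text \<open>The interpolation error is controlled by the first shift energy alone, so
  \<open>a 0\<close> has to be compared with its weight \<open>- a 1\<close>.\<close>

lemma a0_le_first:
  assumes C: "1 \<le> C" and large: "1 < R \<Longrightarrow> 2 * R \<le> C"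
  shows "a 0 \<le> 2 * (C * - a 1)"
proof (cases "R \<le> 1")
  case True
  then have "a 0 = 2 * (1 * - a 1)"
    by (simp add: stiffness_coeff_def offdiag_coeff_small)
  also have "\<dots> \<le> 2 * (C * - a 1)"
    using a1_neg C by (intro mult_left_mono mult_right_mono) auto
  finally show ?thesis .
next
  case False
  then have "(\<Sum>p = 1..L. - a p) \<le> 2 * R * - a 1"
    using offdiag_sum_le_first[OF h_pos, of \<delta>]
    by (subst coeff_sum_large) (simp_all add: stiffness_coeff_def)
  then have "a 0 \<le> 2 * (2 * R * - a 1)" by (simp only: a0_eq)
  also have "\<dots> \<le> 2 * (C * - a 1)"
    using a1_neg large False by (intro mult_left_mono mult_right_mono) auto
  finally show ?thesis .
qed

lemma interpolation_approximation:
  assumes J: "2 \<le> J" and NJ: "N = 2 ^ J - 1"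
    and C: "1 \<le> C" "1 < R \<Longrightarrow> 2 * R \<le> C" and v: "v \<in> carrier_vec N"
  shows "\<exists>w \<in> carrier_vec (2 ^ (J - 1) - 1).
    a 0 * ((v - prolongation J *\<^sub>v w) \<bullet> (v - prolongation J *\<^sub>v w)) \<le> C * ((A *\<^sub>v v) \<bullet> v)"
proof -
  define n :: nat where "n = 2 ^ (J - 1) - 1"
  \<comment> \<open>Sampling at the coarse nodes makes \<open>f\<close> the error of linear
    interpolation.\<close>
  define w where "w = vec n (\<lambda>i. zero_extend v (2 * i + 1))"
  define f where "f = v - prolongation J *\<^sub>v w"
  \<comment> \<open>Writing \<open>J\<close> and the power of two as successors resolves the
    truncated subtractions in \<open>N = 2 * n + 1\<close>.\<close>
  obtain k where k: "J = Suc (Suc k)" using J by (metis add_2_eq_Suc le_Suc_ex)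
  obtain q :: nat where "2 ^ k = Suc q" using not0_implies_Suc[of "2 ^ k"] by auto
  then have Nn: "N = 2 * n + 1" and n: "1 \<le> n" by (simp_all add: NJ n_def k)
  have w: "w \<in> carrier_vec n" by (simp add: w_def)
  have Pw: "prolongation J *\<^sub>v w \<in> carrier_vec N"
    using prolongation_carrier[of J] w by (simp add: NJ n_def)
  have f: "f \<in> carrier_vec N" using v Pw by (simp add: f_def)
  have f_at: "zero_extend f i = zero_extend v i - (prolongation J *\<^sub>v w) $ i" if "i < N" for i
    using that carrier_vecD[OF v] carrier_vecD[OF Pw] carrier_vecD[OF f]
    by (simp add: f_def zero_extend_def del: dim_mult_mat_vec)
  have supp: "zero_extend v i = 0" if "2 * n + 1 \<le> i" for i
    using that v by (simp add: zero_extend_beyond Nn)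
  note w' = w[unfolded n_def]
  have "(\<Sum>k<2 * n + 1. (zero_extend f k)\<^sup>2) \<le> shift_energy (2 * n + 1) (zero_extend v) 1 / 2"
  proof (rule linear_interpolation_error[OF supp])
    show "zero_extend f 0 = zero_extend v 0 - zero_extend v 1 / 2"
      using prolongation_first[OF w' J] n by (simp add: f_at Nn w_def)
    fix i assume i: "i < n"
    show "zero_extend f (2 * i + 1) = 0"
      using prolongation_odd[OF w', of i, folded n_def] i J by (simp add: f_at Nn n_def[symmetric] w_def)
    have last: "zero_extend v (2 * i + 3) = 0" if "\<not> i + 1 < n"
      using that i by (intro supp) simp
    show "zero_extend f (2 * i + 2)
        = zero_extend v (2 * i + 2) - (zero_extend v (2 * i + 1) + zero_extend v (2 * i + 3)) / 2"
      using prolongation_even[OF w', of i, folded n_def] i J last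
      by (auto simp: f_at Nn n_def[symmetric] w_def numeral_3_eq_3)
  qed
  then have "f \<bullet> f \<le> shift_energy N (zero_extend v) 1 / 2"
    using sum_squares_zero_extend[of f] f by (simp add: Nn)
  then have "a 0 * (f \<bullet> f) \<le> a 0 * (shift_energy N (zero_extend v) 1 / 2)"
    using a0_pos by (intro mult_left_mono) auto
  also have "\<dots> \<le> 2 * (C * - a 1) * (shift_energy N (zero_extend v) 1 / 2)"
    using energy_terms(1)[OF v, of 1] by (intro mult_right_mono a0_le_first C) simp_all
  also have "\<dots> = C * (- a 1 * shift_energy N (zero_extend v) 1)"
    by simp
  also have "\<dots> \<le> C * ((A *\<^sub>v v) \<bullet> v)"
    by (intro mult_left_mono energy_ge_first v) (use C in simp)
  finally show ?thesis using w by (auto simp: f_def n_def)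
qed

lemma sum_power2: "6 * (\<Sum>p = 1..m. (real p)\<^sup>2) = real m * (real m + 1) * (2 * real m + 1)"
  by (induction m) (simp_all add: algebra_simps power2_eq_square)

text \<open>The inequalities for \<open>p \<le> m\<close> are summed with the common weight
  \<open>\<kappa>\<close>. The squares of \<open>p\<close> add up to order \<open>m\<close> cubed,
  which outweighs \<open>a 0\<close>, of order \<open>\<kappa> * m\<close>, by the square of
  \<open>R\<close>; and \<open>(N + 1) / R = b / \<delta>\<close> is independent of
  \<open>h\<close>.\<close>

lemma poincare_approximation:
  assumes R: "2 \<le> R" and \<delta>b: "\<delta> < b" and v: "v \<in> carrier_vec N"
  shows "a 0 * (v \<bullet> v) \<le> 648 * b\<^sup>2 / \<delta>\<^sup>2 * ((A *\<^sub>v v) \<bullet> v)"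
proof -
  define r \<kappa> where "r = nat \<lfloor>R\<rfloor>" and "\<kappa> = 3 / (h\<^sup>2 * R ^ 3)"
  \<comment> \<open>The last index with the full coefficient \<open>- \<kappa>\<close>;
    \<open>R \<ge> 2\<close> ensures \<open>m \<ge> 1\<close>.\<close>
  define m where "m = r - 1"
  have R1: "1 < R" using R by simp
  have \<kappa>: "0 < \<kappa>" using h_pos R by (simp add: \<kappa>_def)
  have "2 \<le> r" using R by (simp add: r_def le_nat_iff le_floor_iff)
  then have r: "r = m + 1" and m: "1 \<le> real m" by (simp_all add: m_def)
  have "R < real r + 1" using R by (simp add: r_def)
  then have Rm: "R \<le> real m + 2" by (simp add: r)
  have "R = (real N + 1) * (\<delta> / b)" by (simp add: h_def)
  also have "\<dots> < (real N + 1) * 1" using \<delta>b b by (intro mult_strict_left_mono) auto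
  finally have "R < real N + 1" by simp
  moreover have "real r \<le> R" using R by (simp add: r_def)
  ultimately have "m \<le> N" by (simp add: r)
  have vv: "0 \<le> v \<bullet> v" by (simp add: scalar_prod_def sum_nonneg)
  have "(\<Sum>p = 1..m. (real p)\<^sup>2) * (v \<bullet> v)
      \<le> 4 * (real N + 1)\<^sup>2 * (\<Sum>p = 1..m. shift_energy N (zero_extend v) p)"
    unfolding sum_distrib_left sum_distrib_right
    using energy_terms(3)[OF v] \<open>m \<le> N\<close> by (intro sum_mono) auto
  then have poinc: "\<kappa> * ((\<Sum>p = 1..m. (real p)\<^sup>2) * (v \<bullet> v))
      \<le> \<kappa> * (4 * (real N + 1)\<^sup>2 * (\<Sum>p = 1..m. shift_energy N (zero_extend v) p))"
    using \<kappa> by (intro mult_left_mono) auto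
  have "\<kappa> * (\<Sum>p = 1..m. shift_energy N (zero_extend v) p)
      = (\<Sum>p = 1..m. - a p * shift_energy N (zero_extend v) p)"
    unfolding sum_distrib_left
  proof (intro sum.cong refl)
    fix p assume "p \<in> {1..m}"
    then have "a p = - \<kappa>"
      using R by (simp add: stiffness_coeff_def offdiag_coeff_def Let_def r_def[symmetric] r \<kappa>_def)
    then show "\<kappa> * shift_energy N (zero_extend v) p = - a p * shift_energy N (zero_extend v) p"
      by simp
  qed
  also have "\<dots> \<le> (A *\<^sub>v v) \<bullet> v"
    unfolding energy_eq[OF v] using a_nonpos energy_terms(1)[OF v] \<open>m \<le> N\<close> L_ge(2)
    by (intro sum_mono2) (auto intro!: mult_nonpos_nonneg)
  finally have "4 * (real N + 1)\<^sup>2 * (\<kappa> * (\<Sum>p = 1..m. shift_energy N (zero_extend v) p))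
      \<le> 4 * (real N + 1)\<^sup>2 * ((A *\<^sub>v v) \<bullet> v)"
    by (intro mult_left_mono) auto
  then have E: "\<kappa> * ((\<Sum>p = 1..m. (real p)\<^sup>2) * (v \<bullet> v)) \<le> 4 * (real N + 1)\<^sup>2 * ((A *\<^sub>v v) \<bullet> v)"
    using poinc by (simp only: mult.left_commute[of \<kappa>])
  have "(\<Sum>p = 1..L. - a p) \<le> \<kappa> * (real r + 1 / 2)"
    unfolding coeff_sum_large[OF R1] r_def \<kappa>_def by (rule offdiag_sum_le[OF h_pos R1])
  then have "a 0 \<le> 2 * (\<kappa> * (real r + 1 / 2))"
    unfolding a0_eq by (rule mult_left_mono) simp
  also have "\<dots> = \<kappa> * (2 * real m + 3)" by (simp add: r algebra_simps)
  finally have "a 0 \<le> \<kappa> * (2 * real m + 3)" .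
  then have "R\<^sup>2 * (a 0 * (v \<bullet> v)) \<le> R\<^sup>2 * (\<kappa> * (2 * real m + 3) * (v \<bullet> v))"
    using vv by (intro mult_left_mono mult_right_mono) auto
  also have "\<dots> = \<kappa> * (R\<^sup>2 * (2 * real m + 3) * (v \<bullet> v))" by simp
  also have "\<dots> \<le> \<kappa> * (162 * (\<Sum>p = 1..m. (real p)\<^sup>2) * (v \<bullet> v))"
  proof (intro mult_left_mono mult_right_mono)
    have "R\<^sup>2 * (2 * real m + 3) \<le> (real m + 2)\<^sup>2 * (2 * real m + 3)"
      using Rm R by (intro mult_right_mono power_mono) auto
    \<comment> \<open>As polynomials in \<open>q = m - 1 \<ge> 0\<close> both sides have nonnegative
      coefficients, and the right side dominates coefficientwise. With \<open>6 * 27 = 162\<close>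
      from the sum of squares and 4 from the Poincare inequality this gives 648.\<close>
    also have "\<dots> \<le> 27 * (real m * (real m + 1) * (2 * real m + 1))"
    proof -
      define q where "q = real m - 1"
      have "0 \<le> q" "real m = q + 1" using m by (simp_all add: q_def)
      then show ?thesis
        by (simp add: power2_eq_square algebra_simps)
    qed
    also have "\<dots> = 162 * (\<Sum>p = 1..m. (real p)\<^sup>2)"
      using sum_power2[of m] by simp
    finally show "R\<^sup>2 * (2 * real m + 3) \<le> 162 * (\<Sum>p = 1..m. (real p)\<^sup>2)" .
  qed (use vv \<kappa> in auto)
  also have "\<dots> \<le> 162 * (4 * (real N + 1)\<^sup>2 * ((A *\<^sub>v v) \<bullet> v))"
    using mult_left_mono[OF E, of 162] by (simp add: mult_ac)
  finally have "a 0 * (v \<bullet> v) * R\<^sup>2 \<le> 648 * (real N + 1)\<^sup>2 * ((A *\<^sub>v v) \<bullet> v)"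
    by (simp add: mult_ac)
  then have "a 0 * (v \<bullet> v) \<le> 648 * (real N + 1)\<^sup>2 * ((A *\<^sub>v v) \<bullet> v) / R\<^sup>2"
    using R by (subst pos_le_divide_eq) auto
  also have "\<dots> = 648 * ((real N + 1)\<^sup>2 / R\<^sup>2) * ((A *\<^sub>v v) \<bullet> v)"
    by simp
  also have "(real N + 1)\<^sup>2 / R\<^sup>2 = b\<^sup>2 / \<delta>\<^sup>2"
    using b \<delta> by (simp add: h_def power_divide power_mult_distrib)
  finally show ?thesis by simp
qed

end

theorem theorem3p9:
  fixes b c \<beta> \<omega> \<eta> :: real
  assumes "b > 0" and "c > 0" and "\<beta> \<ge> 0"
    and "0 < \<omega>" and "\<omega> < 1"
    and "0 < \<eta>" and "\<eta> \<le> 2 * \<omega> * (1 - \<omega>)"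
  shows "\<exists>h0 > 0. \<forall>J::nat. \<forall>h \<delta> :: real. \<forall>A K T :: real mat.
    2 \<le> J \<longrightarrow> h = b / 2^J \<longrightarrow> h < h0 \<longrightarrow> \<delta> = c * h powr \<beta> \<longrightarrow> \<delta> < b \<longrightarrow>
    A = stiffness_matrix b (2^J - 1) \<delta> \<longrightarrow>
    K = damped_jacobi \<omega> A \<longrightarrow>
    T = coarse_correction J A \<longrightarrow>
      (\<forall>\<nu> \<in> carrier_vec (2^J - 1).
         (vec_norm A (K *\<^sub>v \<nu>))^2
           \<le> (vec_norm A \<nu>)^2 - \<eta> * (vec_norm (inv_mat (diag_part A)) (A *\<^sub>v \<nu>))^2) \<and>
      (\<beta> \<ge> 1 \<longrightarrow>
         mat_norm A (K * T) \<le> sqrt (1 - \<eta> / max 1 (2 * c)) \<and>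
         sqrt (1 - \<eta> / max 1 (2 * c)) < 1) \<and>
      (\<beta> = 0 \<longrightarrow>
         mat_norm A (K * T) \<le> sqrt (1 - \<eta> * c^2 / (648 * b^2)) \<and>
         sqrt (1 - \<eta> * c^2 / (648 * b^2)) < 1)"
proof -
  \<comment> \<open>For \<open>\<beta> = 0\<close> the threshold forces
    \<open>R = c / h \<ge> 2\<close>; for \<open>\<beta> > 1\<close> it forces
    \<open>R = c * h powr (\<beta> - 1) \<le> 1\<close>. For \<open>\<beta> = 1\<close> the ratio
    \<open>R = c\<close> does not depend on \<open>h\<close>, and for \<open>0 < \<beta> < 1\<close>
    only the smoothing inequality is claimed, so any positive value serves.\<close>
  define h0 where "h0 = (if \<beta> = 0 then c / 2 else if \<beta> > 1 then (1 / c) powr (1 / (\<beta> - 1)) else 1)"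
  have "0 < h0" using \<open>c > 0\<close> by (simp add: h0_def)
  show ?thesis
  proof (intro exI[of _ h0] conjI allI impI ballI \<open>0 < h0\<close>)
    fix J :: nat and h \<delta> :: real and A K T :: "real mat"
    assume J: "2 \<le> J" and h_eq: "h = b / 2 ^ J" and small: "h < h0" and delta_eq: "\<delta> = c * h powr \<beta>"
      and \<delta>b: "\<delta> < b" and A: "A = stiffness_matrix b (2 ^ J - 1) \<delta>"
      and K: "K = damped_jacobi \<omega> A" and T: "T = coarse_correction J A"
    have h_pos: "0 < h" using \<open>b > 0\<close> by (simp add: h_eq)
    have "0 < \<delta>" using h_pos \<open>c > 0\<close> by (simp add: delta_eq)
    interpret stiffness b \<delta> h "2 ^ J - 1"
    proof
      have "(2::nat) ^ 1 \<le> 2 ^ J" using J by (intro power_increasing) auto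
      then show "(1::nat) \<le> 2 ^ J - 1" by simp
    qed (use \<open>b > 0\<close> \<open>0 < \<delta>\<close> in \<open>simp_all add: h_eq of_nat_diff\<close>)
    show "(vec_norm A (K *\<^sub>v \<nu>))\<^sup>2
        \<le> (vec_norm A \<nu>)\<^sup>2 - \<eta> * (vec_norm (inv_mat (diag_part A)) (A *\<^sub>v \<nu>))\<^sup>2"
      if "\<nu> \<in> carrier_vec (2 ^ J - 1)" for \<nu>
      unfolding K A
      by (rule jacobi_smoothing[OF A_carrier A_sym A_diag a0_pos energy_nonneg energy_le
            \<open>\<eta> \<le> 2 * \<omega> * (1 - \<omega>)\<close> that])
    \<comment> \<open>The two open premises are the approximation property and
      \<open>1 \<le> C\<close>; they are supplied separately in each regime.\<close>
    note factor = two_grid_bound[OF J A_carrier A_sym A_diag a0_pos energy_pos energy_le _ _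
        \<open>0 < \<eta>\<close> \<open>\<eta> \<le> 2 * \<omega> * (1 - \<omega>)\<close>, folded A, folded K T]
    show "mat_norm A (K * T) \<le> sqrt (1 - \<eta> / max 1 (2 * c))" if \<beta>: "1 \<le> \<beta>"
    proof (rule factor)
      have R: "R = c * h powr (\<beta> - 1)"
        using h_pos by (simp add: delta_eq powr_diff)
      have "2 * R \<le> max 1 (2 * c)" if "1 < R"
      proof (cases "\<beta> = 1")
        case True
        then show ?thesis using h_pos by (simp add: R)
      next
        case False
        then have "h powr (\<beta> - 1) \<le> ((1 / c) powr (1 / (\<beta> - 1))) powr (\<beta> - 1)"
          using \<beta> small h_pos by (intro powr_mono2) (auto simp: h0_def)
        also have "\<dots> = 1 / c" using False \<open>c > 0\<close> by (simp add: powr_powr)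
        finally have "R \<le> 1" using \<open>c > 0\<close> by (simp add: R field_simps)
        with that show ?thesis by simp
      qed
      then show "\<exists>w \<in> carrier_vec (2 ^ (J - 1) - 1).
          a 0 * ((e - prolongation J *\<^sub>v w) \<bullet> (e - prolongation J *\<^sub>v w)) \<le> max 1 (2 * c) * ((A *\<^sub>v e) \<bullet> e)"
        if "e \<in> carrier_vec (2 ^ J - 1)" for e
        unfolding A using that by (intro interpolation_approximation J) auto
    qed (assumption | rule max.cobounded1)+
    show "sqrt (1 - \<eta> / max 1 (2 * c)) < 1"
      using \<open>0 < \<eta>\<close> by simp
    show "mat_norm A (K * T) \<le> sqrt (1 - \<eta> * c\<^sup>2 / (648 * b\<^sup>2))" if "\<beta> = 0"
    proof -
      have "\<delta> = c" using that h_pos by (simp add: delta_eq)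
      have "2 \<le> R" using small that h_pos by (simp add: \<open>\<delta> = c\<close> h0_def field_simps)
      have "mat_norm A (K * T) \<le> sqrt (1 - \<eta> / (648 * b\<^sup>2 / \<delta>\<^sup>2))"
      proof (rule factor)
        fix e :: "real vec" assume e: "e \<in> carrier_vec (2 ^ J - 1)"
        have zero: "prolongation J *\<^sub>v 0\<^sub>v (2 ^ (J - 1) - 1) = 0\<^sub>v (2 ^ J - 1)"
          using prolongation_carrier[of J] by (intro eq_vecI) auto
        have "e - prolongation J *\<^sub>v 0\<^sub>v (2 ^ (J - 1) - 1) = e"
          unfolding zero using e by auto
        note trivial = arg_cong[OF this, of "\<lambda>f. a 0 * (f \<bullet> f)"]
        show "\<exists>w \<in> carrier_vec (2 ^ (J - 1) - 1).
            a 0 * ((e - prolongation J *\<^sub>v w) \<bullet> (e - prolongation J *\<^sub>v w))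
              \<le> 648 * b\<^sup>2 / \<delta>\<^sup>2 * ((A *\<^sub>v e) \<bullet> e)"
          unfolding A using poincare_approximation[OF \<open>2 \<le> R\<close> \<delta>b e]
          by (intro bexI[of _ "0\<^sub>v (2 ^ (J - 1) - 1)"]) (simp_all only: trivial zero_carrier_vec)
      next
        have "\<delta>\<^sup>2 \<le> b\<^sup>2" using \<delta>b \<open>0 < \<delta>\<close> by (intro power_mono) auto
        also have "\<dots> \<le> 648 * b\<^sup>2" by simp
        finally show "1 \<le> 648 * b\<^sup>2 / \<delta>\<^sup>2" using \<open>0 < \<delta>\<close> by simp
      qed
      then show ?thesis by (simp add: \<open>\<delta> = c\<close>)
    qed
    show "sqrt (1 - \<eta> * c\<^sup>2 / (648 * b\<^sup>2)) < 1"
      using \<open>0 < \<eta>\<close> \<open>b > 0\<close> \<open>c > 0\<close> by simp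
  qed
qed

end
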